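(* Let $\Gamma$ be a group and let $\Lambda\leq\Gamma$ be a commensurated subgroup. Then the action $\Lambda\curvearrowright\partial_p\Lambda$ extends in a unique way to an action of $\Gamma$ on $\partial_p\Lambda$ (by homeomorphisms). Furthermore, with respect to this extended action, given $s\in\Gamma$: if $s\in C_\Gamma(\Lambda\cap s^{-1}\Lambda s)$, then $\mathrm{Fix}(s)=\partial_p\Lambda$. Conversely, if $\Lambda\curvearrowright\partial_p\Lambda$ is free and $\mathrm{Fix}(s)\neq\emptyset$, then $s\in C_\Gamma(\Lambda\cap s^{-1}\Lambda s)$.
   Context: Groups are discrete. A subgroup $\Lambda\leq\Gamma$ is commensurated if $[\Lambda:\Lambda\cap g\Lambda g^{-1}]<\infty$ for every $g\in\Gamma$. $C_\Gamma(S)$ denotes the centralizer in $\Gamma$ of a subset $S\subset\Gamma$, and $\mathrm{Fix}(s)$ is the set of points fixed by $s$. For an action of a group $G$ by homeomorphisms on a compact Hausdorff space $X$: the action is minimal if $X$ contains no non-trivial (non-empty proper) closed invariant subset; it is proximal if for all $x,y\in X$ there is a net $(g_i)\subset G$ such that $(g_ix)$ and $(g_iy)$ converge and $\lim g_ix=\lim g_iy$. $\partial_pG$ denotes the universal minimal proximal $G$-space, i.e. the (unique up to $G$-equivariant homeomorphism) minimal proximal compact Hausdorff $G$-space of which every minimal proximal compact Hausdorff $G$-space is a continuous $G$-equivariant image. *)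

theory Defs
  imports "HOL-Analysis.Analysis" "HOL-Algebra.Group_Action"
begin

definition commensurated :: "('g, 'b) monoid_scheme \<Rightarrow> 'g set \<Rightarrow> bool" where
  "commensurated G L \<longleftrightarrow> subgroup L G \<and>
     (\<forall>g\<in>carrier G. finite (rcosets\<^bsub>G\<lparr>carrier := L\<rparr>\<^esub> (L \<inter> (g <#\<^bsub>G\<^esub> L #>\<^bsub>G\<^esub> inv\<^bsub>G\<^esub> g))))"

definition centralizer :: "('g, 'b) monoid_scheme \<Rightarrow> 'g set \<Rightarrow> 'g set" where
  "centralizer G S = {g \<in> carrier G. \<forall>h\<in>S. g \<otimes>\<^bsub>G\<^esub> h = h \<otimes>\<^bsub>G\<^esub> g}"

text \<open>
  Actions are those of \<open>group_action\<close>; in particular every \<open>\<phi> g\<close> with \<open>g\<close> in the group is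
  \<open>undefined\<close> outside the space. The set of fixed points of \<open>g\<close> is \<open>invariants (topspace X) \<phi> g\<close>.
\<close>

definition action_by_homeos ::
  "('g, 'b) monoid_scheme \<Rightarrow> 'x topology \<Rightarrow> ('g \<Rightarrow> 'x \<Rightarrow> 'x) \<Rightarrow> bool" where
  "action_by_homeos G X \<phi> \<longleftrightarrow>
     group_action G (topspace X) \<phi> \<and> (\<forall>g\<in>carrier G. homeomorphic_map X X (\<phi> g))"

definition extending_action ::
  "('g, 'b) monoid_scheme \<Rightarrow> 'g set \<Rightarrow> 'x topology \<Rightarrow> ('g \<Rightarrow> 'x \<Rightarrow> 'x) \<Rightarrow> ('g \<Rightarrow> 'x \<Rightarrow> 'x) \<Rightarrow> bool"
  where
  "extending_action G L X \<phi> \<Phi> \<longleftrightarrow>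
     action_by_homeos G X \<Phi> \<and> (\<forall>g\<in>L. \<forall>x\<in>topspace X. \<Phi> g x = \<phi> g x)"

definition minimal_action ::
  "('g, 'b) monoid_scheme \<Rightarrow> 'x topology \<Rightarrow> ('g \<Rightarrow> 'x \<Rightarrow> 'x) \<Rightarrow> bool" where
  "minimal_action G X \<phi> \<longleftrightarrow>
     (\<forall>C. closedin X C \<and> (\<forall>g\<in>carrier G. \<phi> g ` C \<subseteq> C) \<longrightarrow> C = {} \<or> C = topspace X)"

text \<open>
  The nets \<open>(g\<^sub>i)\<close> in the definition of proximality are rendered by proper filters on the group:
  a net gives the filter generated by its tails, and conversely a proper filter \<open>F\<close> gives the net
  \<open>(g, A) \<mapsto> g\<close> indexed by the pairs \<open>g \<in> A\<close> with \<open>A\<close> in \<open>F\<close>.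
\<close>

definition proximal_action ::
  "('g, 'b) monoid_scheme \<Rightarrow> 'x topology \<Rightarrow> ('g \<Rightarrow> 'x \<Rightarrow> 'x) \<Rightarrow> bool" where
  "proximal_action G X \<phi> \<longleftrightarrow>
     (\<forall>x\<in>topspace X. \<forall>y\<in>topspace X. \<exists>F z. F \<noteq> bot \<and> (\<forall>\<^sub>F g in F. g \<in> carrier G) \<and>
        limitin X (\<lambda>g. \<phi> g x) z F \<and> limitin X (\<lambda>g. \<phi> g y) z F)"

definition free_action ::
  "('g, 'b) monoid_scheme \<Rightarrow> 'x topology \<Rightarrow> ('g \<Rightarrow> 'x \<Rightarrow> 'x) \<Rightarrow> bool" where
  "free_action G X \<phi> \<longleftrightarrow>
     (\<forall>g\<in>carrier G. g \<noteq> \<one>\<^bsub>G\<^esub> \<longrightarrow> invariants (topspace X) \<phi> g = {})"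

text \<open>Spaces are non-empty: the empty space is not an image of any other space, so it has to be
  excluded for a universal space to exist.\<close>

definition minimal_proximal_space ::
  "('g, 'b) monoid_scheme \<Rightarrow> 'x topology \<Rightarrow> ('g \<Rightarrow> 'x \<Rightarrow> 'x) \<Rightarrow> bool" where
  "minimal_proximal_space G X \<phi> \<longleftrightarrow>
     topspace X \<noteq> {} \<and> compact_space X \<and> Hausdorff_space X \<and>
     action_by_homeos G X \<phi> \<and> minimal_action G X \<phi> \<and> proximal_action G X \<phi>"

definition equivariant_image ::
  "('g, 'b) monoid_scheme \<Rightarrow> 'x topology \<Rightarrow> ('g \<Rightarrow> 'x \<Rightarrow> 'x) \<Rightarrow>
     'y topology \<Rightarrow> ('g \<Rightarrow> 'y \<Rightarrow> 'y) \<Rightarrow> bool" where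
  "equivariant_image G X \<phi> Y \<psi> \<longleftrightarrow>
     (\<exists>f. continuous_map X Y f \<and> f ` topspace X = topspace Y \<and>
        (\<forall>g\<in>carrier G. \<forall>x\<in>topspace X. f (\<phi> g x) = \<psi> g (f x)))"

text \<open>
  \<open>(X, \<phi>)\<close> is a model of the universal minimal proximal space of \<open>G\<close>. A definition cannot quantify
  over all types, so the test spaces have their points in \<open>'g set set\<close>. This is no restriction: a
  point \<open>y\<close> of a minimal Hausdorff \<open>G\<close>-space is determined by the sets \<open>A\<close> of group elements such
  that \<open>y\<close> lies in the closure of \<open>A y\<^sub>0\<close>, for a fixed point \<open>y\<^sub>0\<close>. The lemma
  \<open>universal_minimal_proximal_space_image\<close> below has the universal property for test spaces of
  arbitrary type.
\<close>

definition universal_minimal_proximal_space ::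
  "('g, 'b) monoid_scheme \<Rightarrow> 'x topology \<Rightarrow> ('g \<Rightarrow> 'x \<Rightarrow> 'x) \<Rightarrow> bool" where
  "universal_minimal_proximal_space G X \<phi> \<longleftrightarrow>
     minimal_proximal_space G X \<phi> \<and>
     (\<forall>(Y :: 'g set set topology) \<psi>. minimal_proximal_space G Y \<psi> \<longrightarrow> equivariant_image G X \<phi> Y \<psi>)"

lemma group_actionI:
  assumes "group G"
    and "\<And>g. g \<in> carrier G \<Longrightarrow> \<phi> g \<in> Bij E"
    and "\<And>g h x. g \<in> carrier G \<Longrightarrow> h \<in> carrier G \<Longrightarrow> x \<in> E \<Longrightarrow> \<phi> (g \<otimes>\<^bsub>G\<^esub> h) x = \<phi> g (\<phi> h x)"
  shows "group_action G E \<phi>"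
proof -
  interpret group G by fact
  have "\<phi> (g \<otimes>\<^bsub>G\<^esub> h) = compose E (\<phi> g) (\<phi> h)" if "g \<in> carrier G" "h \<in> carrier G" for g h
    using that assms(2)[OF m_closed[OF that]] assms(3)
    by (intro extensionalityI[where A = E]) (auto simp: compose_def Bij_def)
  then have "\<phi> \<in> hom G (BijGroup E)"
    using assms(2) by (auto simp: hom_def BijGroup_def)
  then show ?thesis
    by (simp add: group_action_def group_hom_def group_hom_axioms_def assms(1) group_BijGroup)
qed

lemma minimal_proximal_space_transfer:
  assumes Y: "minimal_proximal_space G Y \<psi>" and e: "inj_on e (topspace Y)"
  obtains Z \<theta> where "minimal_proximal_space G Z \<theta>" "homeomorphic_map Y Z e"
    "\<And>g y. g \<in> carrier G \<Longrightarrow> y \<in> topspace Y \<Longrightarrow> e (\<psi> g y) = \<theta> g (e y)"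
proof -
  define S where "S = topspace Y"
  define d where "d = inv_into S e"
  define Z where "Z = pullback_topology (e ` S) d Y"
  define \<theta> where "\<theta> = (\<lambda>g. restrict (\<lambda>w. e (\<psi> g (d w))) (e ` S))"
  have de [simp]: "d (e y) = y" if "y \<in> S" for y
    using that e by (simp add: d_def S_def)
  have topZ: "topspace Z = e ` S"
    by (auto simp: Z_def topspace_pullback_topology S_def [symmetric])
  have "homeomorphic_maps Y Z e d"
    unfolding homeomorphic_maps_def
  proof (intro conjI)
    show "continuous_map Z Y d"
      using continuous_map_pullback [of Y Y id "e ` S" d] by (simp add: Z_def)
    show "continuous_map Y Z e"
      unfolding Z_def
    proof (rule continuous_map_pullback')
      show "continuous_map Y Y (d \<circ> e)"
        by (rule continuous_map_eq [of Y Y id]) (auto simp: S_def [symmetric])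
      show "topspace Y \<subseteq> e -` e ` S" by (auto simp: S_def)
    qed
  qed (auto simp: topZ S_def [symmetric])
  then have he: "homeomorphic_map Y Z e" and hd: "homeomorphic_map Z Y d"
    using homeomorphic_map_maps homeomorphic_maps_sym by blast+
  have act: "group_action G S \<psi>" and hom: "\<And>g. g \<in> carrier G \<Longrightarrow> homeomorphic_map Y Y (\<psi> g)"
    using Y by (auto simp: minimal_proximal_space_def action_by_homeos_def S_def)
  interpret group_action G S \<psi> by (fact act)
  have inS [simp]: "\<psi> g y \<in> S" if "g \<in> carrier G" "y \<in> S" for g y
    using element_image that by blast
  have eq: "e (\<psi> g y) = \<theta> g (e y)" if "y \<in> S" for g y
    using that by (simp add: \<theta>_def)
  have homZ: "homeomorphic_map Z Z (\<theta> g)" if "g \<in> carrier G" for g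
  proof (rule homeomorphic_map_eq)
    show "homeomorphic_map Z Z (e \<circ> \<psi> g \<circ> d)"
      using he hd hom [OF that] homeomorphic_map_compose by metis
  qed (auto simp: topZ \<theta>_def)
  have actZ: "group_action G (topspace Z) \<theta>"
  proof (rule group_actionI)
    show "group G" using group_hom.axioms(1) group_hom by blast
    show "\<theta> g \<in> Bij (topspace Z)" if "g \<in> carrier G" for g
      using homZ [OF that] by (auto simp: Bij_def homeomorphic_eq_everything_map bij_betw_def topZ \<theta>_def)
    show "\<theta> (g \<otimes>\<^bsub>G\<^esub> h) x = \<theta> g (\<theta> h x)"
      if "g \<in> carrier G" "h \<in> carrier G" "x \<in> topspace Z" for g h x
      using that composition_rule monoid.m_closed [OF group.is_monoid [OF group_hom.axioms(1) [OF group_hom]]]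
      by (auto simp: topZ simp flip: eq)
  qed
  have min: "minimal_action G Z \<theta>"
    unfolding minimal_action_def
  proof (intro allI impI, elim conjE)
    fix C assume C: "closedin Z C" "\<forall>g\<in>carrier G. \<theta> g ` C \<subseteq> C"
    then have CS: "C \<subseteq> e ` S" using closedin_subset topZ by metis
    have "closedin Y (d ` C)"
      using C(1) hd CS topZ homeomorphic_map_closedness by metis
    moreover have "\<psi> g ` d ` C \<subseteq> d ` C" if "g \<in> carrier G" for g
    proof clarify
      fix w assume w: "w \<in> C"
      then obtain y where y: "y \<in> S" "w = e y" using CS by auto
      have "\<psi> g y = d (\<theta> g w)" using that y by (simp flip: eq)
      then show "\<psi> g (d w) \<in> d ` C" using C(2) that w y by auto
    qed
    moreover have "\<forall>C. closedin Y C \<and> (\<forall>g\<in>carrier G. \<psi> g ` C \<subseteq> C) \<longrightarrow> C = {} \<or> C = S"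
      using Y unfolding minimal_proximal_space_def minimal_action_def S_def by metis
    ultimately have "d ` C = {} \<or> d ` C = S"
      by metis
    then show "C = {} \<or> C = topspace Z"
    proof
      assume "d ` C = S"
      have "C = e ` d ` C" using CS by force
      then show ?thesis using \<open>d ` C = S\<close> topZ by simp
    qed simp
  qed
  have prox: "proximal_action G Z \<theta>"
    unfolding proximal_action_def topZ
  proof clarify
    fix x y assume xy: "x \<in> S" "y \<in> S"
    moreover have "proximal_action G Y \<psi>"
      using Y unfolding minimal_proximal_space_def by metis
    ultimately obtain F z where F: "F \<noteq> bot" "\<forall>\<^sub>F g in F. g \<in> carrier G"
      "limitin Y (\<lambda>g. \<psi> g x) z F" "limitin Y (\<lambda>g. \<psi> g y) z F"
      unfolding proximal_action_def S_def by metis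
    have lim: "limitin Z (\<lambda>g. \<theta> g (e u)) (e z) F" if "limitin Y (\<lambda>g. \<psi> g u) z F" "u \<in> S" for u
      using continuous_map_limit [OF homeomorphic_imp_continuous_map [OF he] that(1)] that(2)
      by (simp add: o_def eq)
    then show "\<exists>F z. F \<noteq> bot \<and> (\<forall>\<^sub>F g in F. g \<in> carrier G) \<and>
        limitin Z (\<lambda>g. \<theta> g (e x)) z F \<and> limitin Z (\<lambda>g. \<theta> g (e y)) z F"
      using F(1,2) lim [OF F(3) xy(1)] lim [OF F(4) xy(2)] by metis
  qed
  have "Y homeomorphic_space Z"
    using he homeomorphic_map_imp_homeomorphic_space by blast
  then have "compact_space Z" "Hausdorff_space Z"
    using Y homeomorphic_compact_space homeomorphic_Hausdorff_space
    unfolding minimal_proximal_space_def by blast+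
  moreover have "topspace Z \<noteq> {}"
    using Y by (simp add: topZ S_def minimal_proximal_space_def)
  ultimately have "minimal_proximal_space G Z \<theta>"
    using actZ homZ min prox by (simp add: minimal_proximal_space_def action_by_homeos_def)
  then show thesis
    using that he eq by (simp add: S_def)
qed

lemma minimal_action_inj_set_set:
  fixes G (structure) and Y :: "'y topology"
  assumes Y: "action_by_homeos G Y \<psi>" "minimal_action G Y \<psi>" "Hausdorff_space Y"
    and y0: "y0 \<in> topspace Y"
  shows "inj_on (\<lambda>y. {A. A \<subseteq> carrier G \<and> y \<in> Y closure_of ((\<lambda>g. \<psi> g y0) ` A)}) (topspace Y)"
proof -
  interpret group_action G "topspace Y" \<psi>
    using Y(1) by (simp add: action_by_homeos_def)
  interpret group G
    using group_hom group_hom.axioms(1) by blast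
  let ?O = "(\<lambda>g. \<psi> g y0) ` carrier G"
  have "\<psi> h ` (Y closure_of ?O) \<subseteq> Y closure_of ?O" if h: "h \<in> carrier G" for h
  proof -
    have "continuous_map Y Y (\<psi> h)"
      using Y(1) h by (auto simp: action_by_homeos_def intro: homeomorphic_imp_continuous_map)
    then have "\<psi> h ` (Y closure_of ?O) \<subseteq> Y closure_of (\<psi> h ` ?O)"
      by (rule continuous_map_image_closure_subset)
    also have "\<psi> h ` ?O \<subseteq> ?O"
    proof clarify
      fix g assume g: "g \<in> carrier G"
      show "\<psi> h (\<psi> g y0) \<in> ?O"
        using composition_rule [OF y0 h g] h g by (intro image_eqI [of _ _ "h \<otimes> g"]) auto
    qed
    then have "Y closure_of (\<psi> h ` ?O) \<subseteq> Y closure_of ?O"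
      by (rule closure_of_mono)
    finally show ?thesis .
  qed
  then have "Y closure_of ?O = {} \<or> Y closure_of ?O = topspace Y"
    using Y(2) by (auto simp: minimal_action_def)
  moreover have "?O \<subseteq> topspace Y"
    using element_image y0 by blast
  then have "?O \<subseteq> Y closure_of ?O"
    by (rule closure_of_subset)
  ultimately have dense: "Y closure_of ?O = topspace Y"
    by blast
  show ?thesis
  proof (rule inj_onI, rule ccontr)
    fix y z assume y: "y \<in> topspace Y" and z: "z \<in> topspace Y" and ne: "y \<noteq> z"
      and eq: "{A. A \<subseteq> carrier G \<and> y \<in> Y closure_of ((\<lambda>g. \<psi> g y0) ` A)} =
               {A. A \<subseteq> carrier G \<and> z \<in> Y closure_of ((\<lambda>g. \<psi> g y0) ` A)}"
    obtain U V where UV: "openin Y U" "openin Y V" "y \<in> U" "z \<in> V" "disjnt U V"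
      using Y(3) y z ne unfolding Hausdorff_space_def by metis
    define A where "A = {g \<in> carrier G. \<psi> g y0 \<in> U}"
    have "y \<in> Y closure_of ((\<lambda>g. \<psi> g y0) ` A)"
      unfolding in_closure_of
    proof (intro conjI allI impI)
      fix T assume "y \<in> T \<and> openin Y T"
      then have "y \<in> T \<inter> U" "openin Y (T \<inter> U)" using UV by auto
      moreover have "y \<in> Y closure_of ?O"
        using dense y by simp
      ultimately obtain w where "w \<in> ?O" "w \<in> T \<inter> U"
        unfolding in_closure_of by blast
      then show "\<exists>w. w \<in> (\<lambda>g. \<psi> g y0) ` A \<and> w \<in> T" by (auto simp: A_def)
    qed (fact y)
    then have "z \<in> Y closure_of ((\<lambda>g. \<psi> g y0) ` A)"
      using eq by (auto simp: A_def)
    then obtain w where "w \<in> (\<lambda>g. \<psi> g y0) ` A" "w \<in> V"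
      using UV unfolding in_closure_of by blast
    then show False
      using UV by (auto simp: A_def disjnt_iff)
  qed
qed

lemma universal_minimal_proximal_space_image:
  fixes G :: "('g, 'b) monoid_scheme" and X :: "'x topology" and Y :: "'y topology"
  assumes X: "universal_minimal_proximal_space G X \<phi>" and Y: "minimal_proximal_space G Y \<psi>"
  shows "equivariant_image G X \<phi> Y \<psi>"
proof -
  obtain y0 where y0: "y0 \<in> topspace Y"
    using Y unfolding minimal_proximal_space_def by blast
  have hY: "action_by_homeos G Y \<psi>" "minimal_action G Y \<psi>" "Hausdorff_space Y"
    using Y unfolding minimal_proximal_space_def by blast+
  obtain e :: "'y \<Rightarrow> 'g set set" where e_inj: "inj_on e (topspace Y)"
    by (rule that [OF minimal_action_inj_set_set [OF hY y0]])
  obtain Z \<theta> where Z: "minimal_proximal_space G Z \<theta>" and e: "homeomorphic_map Y Z e"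
    and eq: "\<And>g y. g \<in> carrier G \<Longrightarrow> y \<in> topspace Y \<Longrightarrow> e (\<psi> g y) = \<theta> g (e y)"
    using minimal_proximal_space_transfer [OF Y e_inj] by blast
  obtain d where ed: "homeomorphic_maps Y Z e d"
    using e homeomorphic_map_maps by blast
  obtain f where f: "continuous_map X Z f" "f ` topspace X = topspace Z"
      "\<And>g x. g \<in> carrier G \<Longrightarrow> x \<in> topspace X \<Longrightarrow> f (\<phi> g x) = \<theta> g (f x)"
  proof -
    have "equivariant_image G X \<phi> Z \<theta>"
      using X Z unfolding universal_minimal_proximal_space_def by blast
    then show thesis
      using that unfolding equivariant_image_def by (elim exE conjE) metis
  qed
  have "homeomorphic_map Z Y d"
    using ed homeomorphic_maps_map by blast
  then have d: "continuous_map Z Y d" "d ` topspace Z = topspace Y"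
    by (simp_all add: homeomorphic_imp_continuous_map homeomorphic_imp_surjective_map)
  have act: "group_action G (topspace Y) \<psi>"
    using Y by (simp add: minimal_proximal_space_def action_by_homeos_def)
  have "d (f (\<phi> g x)) = \<psi> g (d (f x))" if g: "g \<in> carrier G" and x: "x \<in> topspace X" for g x
  proof -
    have fx: "f x \<in> topspace Z" and dfx: "d (f x) \<in> topspace Y"
      using f(2) d(2) x by auto
    have "d (f (\<phi> g x)) = d (\<theta> g (e (d (f x))))"
      using f(3) [OF g x] ed fx by (simp add: homeomorphic_maps_def)
    also have "\<dots> = d (e (\<psi> g (d (f x))))"
      by (simp add: eq [OF g dfx])
    also have "\<dots> = \<psi> g (d (f x))"
      using ed group_action.element_image [OF act g dfx refl] by (simp add: homeomorphic_maps_def)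
    finally show ?thesis .
  qed
  moreover have "continuous_map X Y (d \<circ> f)"
    using f(1) d(1) by (rule continuous_map_compose)
  moreover have "(d \<circ> f) ` topspace X = topspace Y"
    by (simp only: image_comp [symmetric] f(2) d(2))
  ultimately show ?thesis
    unfolding equivariant_image_def by (intro exI [of _ "d \<circ> f"]) simp
qed

end

theory Submission
  imports Defs
begin

text \<open>
  A compact Hausdorff space is minimal and proximal if and only if every finite set of points can be
  moved by a group element into any given non-empty open set. This property is inherited by subgroups
  of finite index and makes equivariant maps into the space unique.

  The \<open>\<Lambda>\<close>-space of all \<open>f : \<Gamma> \<rightarrow> X\<close> with \<open>f (h g) = h (f g)\<close> for \<open>h\<close> in \<open>\<Lambda>\<close>, on which \<open>\<Lambda>\<close> acts by right
  translation, is proximal because \<open>\<Lambda>\<close> is commensurated. By universality \<open>X\<close> maps onto a minimal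
  subspace of it, and evaluating the image of \<open>x\<close> at \<open>s\<close> gives maps \<open>\<Phi> s : X \<rightarrow> X\<close> that intertwine \<open>h\<close> with
  \<open>s h s\<^sup>-\<^sup>1\<close> for \<open>h\<close> in \<open>\<Lambda> \<inter> s\<^sup>-\<^sup>1 \<Lambda> s\<close>. Uniqueness of such maps turns them into the action, and makes
  \<open>\<Phi> s\<close> the identity if \<open>s\<close> centralizes \<open>\<Lambda> \<inter> s\<^sup>-\<^sup>1 \<Lambda> s\<close>.

  For the converse, the Gleason cover of \<open>X\<close> is again minimal and proximal, so \<open>X\<close> is extremally
  disconnected and, by Frolik's theorem, the set \<open>U\<close> of fixed points of \<open>s\<close> is open. If \<open>h\<close> moves some
  \<open>y\<close> in \<open>U\<close> and an arbitrary \<open>x\<close> into \<open>U\<close>, then \<open>s h s\<^sup>-\<^sup>1\<close> and \<open>h\<close> agree at \<open>y\<close>, so \<open>s\<close> commutes with \<open>h\<close> by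
  freeness, and \<open>h x\<close> being fixed by \<open>s\<close>, so is \<open>x\<close>. Hence \<open>s\<close> acts trivially.
\<close>

section \<open>Actions by homeomorphisms\<close>

text \<open>The inverse of \<open>\<phi> g\<close> is \<open>\<phi> (inv g)\<close>, which is
  continuous as well, so continuity and the action laws give homeomorphisms.\<close>

lemma action_by_homeosI:
  fixes G (structure)
  assumes G: "group G"
    and ext: "\<And>g. g \<in> carrier G \<Longrightarrow> \<phi> g \<in> extensional (topspace X)"
    and cont: "\<And>g. g \<in> carrier G \<Longrightarrow> continuous_map X X (\<phi> g)"
    and mult: "\<And>g h x. g \<in> carrier G \<Longrightarrow> h \<in> carrier G \<Longrightarrow> x \<in> topspace X \<Longrightarrow>
      \<phi> (g \<otimes> h) x = \<phi> g (\<phi> h x)"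
    and one: "\<And>x. x \<in> topspace X \<Longrightarrow> \<phi> \<one> x = x"
  shows "action_by_homeos G X \<phi>"
proof -
  interpret group G by fact
  have hom: "homeomorphic_map X X (\<phi> g)" if g: "g \<in> carrier G" for g
  proof -
    have "homeomorphic_maps X X (\<phi> g) (\<phi> (inv g))"
      using g mult [of g "inv g"] mult [of "inv g" g] one
      by (auto simp: homeomorphic_maps_def cont)
    then show ?thesis
      using homeomorphic_map_maps by blast
  qed
  have "group_action G (topspace X) \<phi>"
  proof (rule group_actionI [OF G])
    show "\<phi> g \<in> Bij (topspace X)" if "g \<in> carrier G" for g
      using hom [OF that] ext [OF that]
      by (auto simp: Bij_def homeomorphic_eq_everything_map bij_betw_def)
  qed (use mult in auto)
  then show ?thesis
    using hom by (simp add: action_by_homeos_def)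
qed

locale homeo_action =
  fixes G (structure) and X :: "'x topology" and \<phi>
  assumes action: "action_by_homeos G X \<phi>"
begin

sublocale group_action G "topspace X" \<phi>
  using action by (simp add: action_by_homeos_def)

sublocale group G
  using group_hom group_hom.axioms(1) by blast

lemma action_closed [simp]: "g \<in> carrier G \<Longrightarrow> x \<in> topspace X \<Longrightarrow> \<phi> g x \<in> topspace X"
  using element_image by blast

lemma action_one [simp]: "x \<in> topspace X \<Longrightarrow> \<phi> \<one> x = x"
  using id_eq_one by (metis restrict_apply')

lemma action_mult:
  "g \<in> carrier G \<Longrightarrow> h \<in> carrier G \<Longrightarrow> x \<in> topspace X \<Longrightarrow> \<phi> (g \<otimes> h) x = \<phi> g (\<phi> h x)"
  by (rule composition_rule)

lemma action_inv [simp]: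
  assumes "g \<in> carrier G" "x \<in> topspace X"
  shows "\<phi> g (\<phi> (inv g) x) = x" "\<phi> (inv g) (\<phi> g x) = x"
  using assms action_mult [of g "inv g" x] action_mult [of "inv g" g x] by auto

lemma action_homeo: "g \<in> carrier G \<Longrightarrow> homeomorphic_map X X (\<phi> g)"
  using action by (simp add: action_by_homeos_def)

lemma action_continuous: "g \<in> carrier G \<Longrightarrow> continuous_map X X (\<phi> g)"
  by (simp add: action_homeo homeomorphic_imp_continuous_map)

lemma action_extensional: "g \<in> carrier G \<Longrightarrow> \<phi> g \<in> extensional (topspace X)"
  using bij_prop0 by (simp add: Bij_def)

lemma openin_action_preimage:
  "g \<in> carrier G \<Longrightarrow> openin X U \<Longrightarrow> openin X {x \<in> topspace X. \<phi> g x \<in> U}"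
  using action_continuous openin_continuous_map_preimage by blast

end

section \<open>Contracting families of maps\<close>

text \<open>The index set carries no group structure, so that the notion also covers the twisted
  families \<open>\<lambda>h. \<phi> (conjugate s h)\<close> over subsets of a group.\<close>

definition contracting :: "'a set \<Rightarrow> 'x topology \<Rightarrow> ('a \<Rightarrow> 'x \<Rightarrow> 'x) \<Rightarrow> bool" where
  "contracting A X a \<longleftrightarrow>
     (\<forall>S U. finite S \<and> S \<subseteq> topspace X \<and> openin X U \<and> U \<noteq> {} \<longrightarrow> (\<exists>g\<in>A. \<forall>x\<in>S. a g x \<in> U))"

lemma contractingD:
  "contracting A X a \<Longrightarrow> finite S \<Longrightarrow> S \<subseteq> topspace X \<Longrightarrow> openin X U \<Longrightarrow> U \<noteq> {} \<Longrightarrow>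
    \<exists>g\<in>A. \<forall>x\<in>S. a g x \<in> U"
  unfolding contracting_def by blast

lemma contracting_pointD:
  assumes "contracting A X a" "x \<in> topspace X" "openin X U" "U \<noteq> {}"
  shows "\<exists>g\<in>A. a g x \<in> U"
  using contractingD [OF assms(1), of "{x}" U] assms by auto

section \<open>Convergence along filters\<close>

lemma filter_limits_from_neighbourhoods:
  assumes z: "z \<in> topspace X"
    and nbhd: "\<And>U. openin X U \<Longrightarrow> z \<in> U \<Longrightarrow> \<exists>g\<in>A. \<forall>x\<in>S. a g x \<in> U"
  obtains F where "F \<noteq> bot" "\<forall>\<^sub>F g in F. g \<in> A" "\<And>x. x \<in> S \<Longrightarrow> limitin X (\<lambda>g. a g x) z F"
proof -
  define \<U> where "\<U> = {U. openin X U \<and> z \<in> U}"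
  \<comment> \<open>Neighbourhoods may be intersected, so these index sets form a filter base; none
    is empty by \<open>nbhd\<close>, so the filter is proper.\<close>
  define F where "F = (INF U\<in>\<U>. principal {g \<in> A. \<forall>x\<in>S. a g x \<in> U})"
  have ev: "eventually P F \<longleftrightarrow> (\<exists>U\<in>\<U>. \<forall>g\<in>A. (\<forall>x\<in>S. a g x \<in> U) \<longrightarrow> P g)" for P
    unfolding F_def
  proof (subst eventually_INF_base)
    show "\<U> \<noteq> {}" using z by (auto simp: \<U>_def)
    show "\<exists>W\<in>\<U>. principal {g \<in> A. \<forall>x\<in>S. a g x \<in> W}
        \<le> inf (principal {g \<in> A. \<forall>x\<in>S. a g x \<in> U}) (principal {g \<in> A. \<forall>x\<in>S. a g x \<in> V})"
      if "U \<in> \<U>" "V \<in> \<U>" for U V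
      using that by (intro bexI [of _ "U \<inter> V"]) (auto simp: \<U>_def)
  qed (auto simp: eventually_principal)
  show thesis
  proof (rule that)
    show "F \<noteq> bot"
      using nbhd ev [of "\<lambda>_. False"] by (auto simp: trivial_limit_def \<U>_def)
    show "\<forall>\<^sub>F g in F. g \<in> A"
      using z by (subst ev) (auto simp: \<U>_def)
    show "limitin X (\<lambda>g. a g x) z F" if "x \<in> S" for x
      using that z unfolding limitin_def ev \<U>_def by blast
  qed
qed

text \<open>The filter form of passing to a convergent subnet: without a cluster point, finitely
  many open sets, each eventually avoided by \<open>u\<close>, would cover the space.\<close>

lemma compact_space_convergent_subfilter:
  assumes X: "compact_space X" and F: "F \<noteq> bot" and u: "\<forall>\<^sub>F g in F. u g \<in> topspace X"
  obtains F' x where "F' \<le> F" "F' \<noteq> bot" "limitin X u x F'"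
proof -
  have "\<exists>x\<in>topspace X. \<forall>V. openin X V \<and> x \<in> V \<longrightarrow> (\<exists>\<^sub>F g in F. u g \<in> V)"
  proof (rule ccontr)
    assume "\<not> ?thesis"
    then have "\<forall>x\<in>topspace X. \<exists>V. openin X V \<and> x \<in> V \<and> (\<forall>\<^sub>F g in F. u g \<notin> V)"
      by (simp add: not_frequently)
    then obtain V where V: "\<And>x. x \<in> topspace X \<Longrightarrow>
        openin X (V x) \<and> x \<in> V x \<and> (\<forall>\<^sub>F g in F. u g \<notin> V x)"
      by metis
    have "\<forall>U\<in>V ` topspace X. openin X U" and "topspace X \<subseteq> \<Union> (V ` topspace X)"
      using V by auto
    then obtain \<F> where "finite \<F>" "\<F> \<subseteq> V ` topspace X" "topspace X \<subseteq> \<Union> \<F>"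
      using X unfolding compact_space_alt by meson
    then obtain T where T: "finite T" "T \<subseteq> topspace X" "topspace X \<subseteq> \<Union> (V ` T)"
      by (metis finite_subset_image)
    then have "\<forall>\<^sub>F g in F. \<forall>x\<in>T. u g \<notin> V x"
      using V by (auto simp: eventually_ball_finite_distrib)
    then have "\<forall>\<^sub>F g in F. False"
      using u by eventually_elim (use T in auto)
    then show False
      using F by (simp add: trivial_limit_def)
  qed
  then obtain x where x: "x \<in> topspace X"
    and freq: "\<And>V. openin X V \<Longrightarrow> x \<in> V \<Longrightarrow> \<exists>\<^sub>F g in F. u g \<in> V"
    by blast
  \<comment> \<open>Adding the preimages of the neighbourhoods of the cluster point \<open>x\<close>
    forces convergence to \<open>x\<close>; the result is proper because \<open>u\<close> is
    frequently in each neighbourhood.\<close>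
  define F' where "F' = inf F (filtercomap u (nhdsin X x))"
  show thesis
  proof (rule that)
    show "F' \<le> F" by (simp add: F'_def)
    show "F' \<noteq> bot"
    proof
      assume "F' = bot"
      then have "eventually (\<lambda>_. False) F'" by simp
      then obtain P Q where PQ: "eventually P F" "eventually Q (filtercomap u (nhdsin X x))"
        "\<And>g. P g \<Longrightarrow> Q g \<Longrightarrow> False"
        unfolding F'_def eventually_inf by blast
      then obtain R where R: "eventually R (nhdsin X x)" "\<And>g. R (u g) \<Longrightarrow> Q g"
        unfolding eventually_filtercomap by blast
      then obtain V where V: "openin X V" "x \<in> V" "\<And>y. y \<in> V \<Longrightarrow> R y"
        using x unfolding eventually_nhdsin by blast
      have "\<exists>\<^sub>F g in F. u g \<in> V \<and> P g"
        using frequently_eventually_conj [OF freq [OF V(1,2)] PQ(1)] by (simp add: conj_commute)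
      then show False
        using frequently_ex V R PQ(3) by blast
    qed
    show "limitin X u x F'"
      unfolding limitin_def
    proof (intro conjI allI impI)
      fix U assume "openin X U \<and> x \<in> U"
      then have "eventually (\<lambda>g. u g \<in> U) (filtercomap u (nhdsin X x))"
        using x by (intro eventually_filtercomapI) (auto simp: eventually_nhdsin)
      then show "eventually (\<lambda>g. u g \<in> U) F'"
        unfolding F'_def by (rule filter_leD [rotated]) simp
    qed (fact x)
  qed
qed

section \<open>Contraction characterizes minimal proximal spaces\<close>

lemma (in homeo_action) minimal_proximal_spaceI:
  assumes "topspace X \<noteq> {}" "compact_space X" "Hausdorff_space X"
    and con: "contracting (carrier G) X \<phi>"
  shows "minimal_proximal_space G X \<phi>"
proof -
  have "minimal_action G X \<phi>"
    unfolding minimal_action_def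
  proof (intro allI impI, rule ccontr)
    fix C assume C: "closedin X C \<and> (\<forall>g\<in>carrier G. \<phi> g ` C \<subseteq> C)"
      and ne: "\<not> (C = {} \<or> C = topspace X)"
    then have CX: "C \<subseteq> topspace X" using closedin_subset by blast
    then obtain x where x: "x \<in> C" "x \<in> topspace X" using ne by blast
    have "openin X (topspace X - C)" "topspace X - C \<noteq> {}"
      using C ne CX by blast+
    then obtain g where "g \<in> carrier G" "\<phi> g x \<in> topspace X - C"
      using contracting_pointD [OF con x(2)] by blast
    then show False
      using C x by blast
  qed
  moreover have "proximal_action G X \<phi>"
    unfolding proximal_action_def
  proof (intro ballI)
    fix x y assume xy: "x \<in> topspace X" "y \<in> topspace X"
    \<comment> \<open>Contraction reaches every non-empty open set, so the common limit may be taken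
      to be \<open>x\<close> itself.\<close>
    have "\<exists>g\<in>carrier G. \<forall>u\<in>{x, y}. \<phi> g u \<in> U" if "openin X U" "x \<in> U" for U
      using that xy by (intro contractingD [OF con]) auto
    then obtain F where F: "F \<noteq> bot" "\<forall>\<^sub>F g in F. g \<in> carrier G"
      "\<And>u. u \<in> {x, y} \<Longrightarrow> limitin X (\<lambda>g. \<phi> g u) x F"
      using filter_limits_from_neighbourhoods [OF xy(1), of "carrier G" "{x, y}" \<phi>] by blast
    show "\<exists>F z. F \<noteq> bot \<and> (\<forall>\<^sub>F g in F. g \<in> carrier G) \<and>
        limitin X (\<lambda>g. \<phi> g x) z F \<and> limitin X (\<lambda>g. \<phi> g y) z F"
      using F by blast
  qed
  ultimately show ?thesis
    using assms action by (simp add: minimal_proximal_space_def)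
qed

text \<open>The points whose orbit misses \<open>U\<close> form a closed invariant set. It omits the
  points of \<open>U\<close>, so minimality leaves only the empty set.\<close>

lemma (in homeo_action) minimal_orbit_dense:
  assumes "minimal_action G X \<phi>" and x: "x \<in> topspace X" and U: "openin X U" "U \<noteq> {}"
  shows "\<exists>g\<in>carrier G. \<phi> g x \<in> U"
proof (rule ccontr)
  assume none: "\<not> ?thesis"
  define C where "C = (\<Inter>g\<in>carrier G. {y \<in> topspace X. \<phi> g y \<in> topspace X - U})"
  have "closedin X C"
    unfolding C_def using one_closed U
    by (intro closedin_Inter)
      (auto intro!: closedin_continuous_map_preimage [OF action_continuous] simp del: Diff_iff)
  moreover have "\<phi> h y \<in> C" if "h \<in> carrier G" "y \<in> C" for h y
    using that by (force simp: C_def simp flip: action_mult)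
  moreover have "x \<in> C"
    using none x by (auto simp: C_def)
  ultimately have "C = topspace X"
    using assms(1) unfolding minimal_action_def by blast
  moreover obtain y where "y \<in> U" "y \<in> topspace X"
    using U openin_subset by blast
  ultimately have "y \<in> C"
    by simp
  then have "\<phi> \<one> y \<notin> U"
    unfolding C_def using one_closed by blast
  then show False
    using \<open>y \<in> U\<close> \<open>y \<in> topspace X\<close> by simp
qed

text \<open>Induction on the number of points. A filter gathers all but one point at some
  \<open>w\<close> while the last one converges to some \<open>v\<close>; proximality brings
  \<open>w\<close> and \<open>v\<close> together, and minimality moves their meeting place into
  \<open>U\<close>.\<close>

lemma minimal_proximal_space_contracting:
  fixes G (structure)
  assumes mp: "minimal_proximal_space G X \<phi>"
  shows "contracting (carrier G) X \<phi>"
proof -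
  interpret homeo_action G X \<phi>
    using mp by (simp add: homeo_action_def minimal_proximal_space_def)
  have X: "topspace X \<noteq> {}" "compact_space X" and min: "minimal_action G X \<phi>"
    and prox: "proximal_action G X \<phi>"
    using mp by (auto simp: minimal_proximal_space_def)
  have "\<forall>U. openin X U \<and> U \<noteq> {} \<longrightarrow> (\<exists>g\<in>carrier G. \<forall>x\<in>S. \<phi> g x \<in> U)"
    if "finite S" "S \<subseteq> topspace X" for S
    using that
  proof (induction S)
    case empty
    then show ?case using one_closed by auto
  next
    case (insert y S)
    then have y: "y \<in> topspace X" and S: "S \<subseteq> topspace X" by auto
    \<comment> \<open>The induction hypothesis reaches every non-empty open set, so any point will
      do for \<open>w\<close>.\<close>
    obtain w where w: "w \<in> topspace X" using X by blast
    obtain F where F: "F \<noteq> bot" "\<forall>\<^sub>F g in F. g \<in> carrier G"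
      "\<And>x. x \<in> S \<Longrightarrow> limitin X (\<lambda>g. \<phi> g x) w F"
      by (rule filter_limits_from_neighbourhoods [OF w, of "carrier G" S \<phi>])
        (use insert.IH S in auto)
    have "\<forall>\<^sub>F g in F. \<phi> g y \<in> topspace X"
      using F(2) by eventually_elim (use y in auto)
    then obtain F' v where F': "F' \<le> F" "F' \<noteq> bot" and v: "limitin X (\<lambda>g. \<phi> g y) v F'"
      by (rule compact_space_convergent_subfilter [OF X(2) F(1)])
    have vX: "v \<in> topspace X" using v by (rule limitin_topspace)
    show ?case
    proof (intro allI impI, elim conjE)
      fix U assume U: "openin X U" "U \<noteq> {}"
      obtain H z where H: "H \<noteq> bot" "\<forall>\<^sub>F g in H. g \<in> carrier G"
        "limitin X (\<lambda>g. \<phi> g w) z H" "limitin X (\<lambda>g. \<phi> g v) z H"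
        using prox w vX unfolding proximal_action_def by blast
      have z: "z \<in> topspace X" using H(3) by (rule limitin_topspace)
      obtain k where k: "k \<in> carrier G" "\<phi> k z \<in> U"
        using minimal_orbit_dense [OF min z U] by blast
      define W where "W = {x \<in> topspace X. \<phi> k x \<in> U}"
      have W: "openin X W" "z \<in> W"
        using k z U by (auto simp: W_def openin_action_preimage)
      have "\<forall>\<^sub>F h in H. h \<in> carrier G \<and> \<phi> h w \<in> W \<and> \<phi> h v \<in> W"
        using H(2) limitinD [OF H(3) W] limitinD [OF H(4) W] by eventually_elim auto
      then obtain h where h: "h \<in> carrier G" "\<phi> h w \<in> W" "\<phi> h v \<in> W"
        using eventually_happens' [OF H(1)] by blast
      \<comment> \<open>This is \<open>U\<close> pulled back through \<open>k\<close> and then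
        \<open>h\<close>. It contains both limits \<open>w\<close> and \<open>v\<close>, so some
        \<open>g\<close> moves all the points into it.\<close>
      define V where "V = {x \<in> topspace X. \<phi> h x \<in> W}"
      have V: "openin X V" "w \<in> V" "v \<in> V"
        using h w vX W by (auto simp: V_def openin_action_preimage)
      have "\<forall>\<^sub>F g in F. g \<in> carrier G \<and> (\<forall>x\<in>S. \<phi> g x \<in> V)"
        using F(2) limitinD [OF F(3) V(1,2)] insert.hyps(1)
        by (auto intro!: eventually_conj eventually_ball_finite)
      then have "\<forall>\<^sub>F g in F'. g \<in> carrier G \<and> (\<forall>x\<in>S. \<phi> g x \<in> V)"
        by (rule filter_leD [OF F'(1)])
      then have "\<forall>\<^sub>F g in F'. g \<in> carrier G \<and> (\<forall>x\<in>insert y S. \<phi> g x \<in> V)"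
        using limitinD [OF v V(1,3)] by eventually_elim auto
      then obtain g where g: "g \<in> carrier G" "\<And>x. x \<in> insert y S \<Longrightarrow> \<phi> g x \<in> V"
        using eventually_happens' [OF F'(2)] by blast
      have "\<phi> (k \<otimes> (h \<otimes> g)) x \<in> U" if "x \<in> insert y S" for x
        using that g(2) [OF that] g(1) h k(1) insert.prems by (auto simp: V_def W_def action_mult)
      then show "\<exists>g\<in>carrier G. \<forall>x\<in>insert y S. \<phi> g x \<in> U"
        using g(1) h(1) k(1) by (intro bexI [of _ "k \<otimes> (h \<otimes> g)"]) auto
    qed
  qed
  then show ?thesis
    by (simp add: contracting_def)
qed

text \<open>Contract \<open>f x\<close> and \<open>g x\<close> to \<open>f x\<close> along a filter
  on which \<open>a n x\<close> also converges, to some \<open>x'\<close>. Then \<open>f\<close> and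
  \<open>g\<close> agree at \<open>x'\<close>, hence at all \<open>a n x'\<close>; but one of these
  points lies in the open set \<open>U\<close>, on which \<open>f\<close> and \<open>g\<close>
  differ.\<close>

lemma contracting_equivariant_unique:
  assumes X: "compact_space X" and Y: "Hausdorff_space Y"
    and a: "contracting A X a" and b: "contracting A Y b"
    and aX: "\<And>n x. n \<in> A \<Longrightarrow> x \<in> topspace X \<Longrightarrow> a n x \<in> topspace X"
    and f: "continuous_map X Y f" "\<And>n x. n \<in> A \<Longrightarrow> x \<in> topspace X \<Longrightarrow> f (a n x) = b n (f x)"
    and g: "continuous_map X Y g" "\<And>n x. n \<in> A \<Longrightarrow> x \<in> topspace X \<Longrightarrow> g (a n x) = b n (g x)"
    and x: "x \<in> topspace X"
  shows "f x = g x"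
proof (rule ccontr)
  assume ne: "f x \<noteq> g x"
  have fx: "f x \<in> topspace Y" "g x \<in> topspace Y"
    using f(1) g(1) x continuous_map_image_subset_topspace by fastforce+
  then obtain V W where VW: "openin Y V" "openin Y W" "f x \<in> V" "g x \<in> W" "disjnt V W"
    using Y ne unfolding Hausdorff_space_def by metis
  define U where "U = {u \<in> topspace X. f u \<in> V} \<inter> {u \<in> topspace X. g u \<in> W}"
  have U: "openin X U" "U \<noteq> {}"
    using VW x openin_continuous_map_preimage [OF f(1)] openin_continuous_map_preimage [OF g(1)]
    by (auto simp: U_def)
  have "\<exists>n\<in>A. \<forall>y\<in>{f x, g x}. b n y \<in> U" if "openin Y U" "f x \<in> U" for U
    using that fx by (intro contractingD [OF b]) auto
  then obtain F where F: "F \<noteq> bot" "\<forall>\<^sub>F n in F. n \<in> A"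
    "\<And>y. y \<in> {f x, g x} \<Longrightarrow> limitin Y (\<lambda>n. b n y) (f x) F"
    using filter_limits_from_neighbourhoods [OF fx(1), of A "{f x, g x}" b] by blast
  have "\<forall>\<^sub>F n in F. a n x \<in> topspace X"
    using F(2) by eventually_elim (use aX x in auto)
  then obtain F' x' where F': "F' \<le> F" "F' \<noteq> bot" and x': "limitin X (\<lambda>n. a n x) x' F'"
    by (rule compact_space_convergent_subfilter [OF X F(1)])
  have A: "\<forall>\<^sub>F n in F'. n \<in> A"
    using F(2) F'(1) by (rule filter_leD [rotated])
  \<comment> \<open>Applied to \<open>f\<close> and to \<open>g\<close>: in both cases
    \<open>k x'\<close> is the limit of \<open>b n (k x)\<close>, which tends to
    \<open>f x\<close>.\<close>
  have lim: "k x' = f x" if "continuous_map X Y k"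
    "\<And>n u. n \<in> A \<Longrightarrow> u \<in> topspace X \<Longrightarrow> k (a n u) = b n (k u)" "k x \<in> {f x, g x}" for k
  proof (rule limitin_Hausdorff_unique [OF _ _ _ Y])
    show "limitin Y (k \<circ> (\<lambda>n. a n x)) (k x') F'"
      using that(1) x' by (rule continuous_map_limit)
    have "limitin Y (\<lambda>n. b n (k x)) (f x) F'"
      using F(3) [OF that(3)] filter_leD [OF F'(1)] by (auto simp: limitin_def)
    then show "limitin Y (k \<circ> (\<lambda>n. a n x)) (f x) F'"
      by (rule limitin_transform_eventually [rotated])
        (use A in \<open>eventually_elim, simp add: that(2) x\<close>)
    show "F' \<noteq> bot" by fact
  qed
  have eq: "f x' = g x'"
    using lim [of f] lim [of g] f g by auto
  have x'X: "x' \<in> topspace X"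
    using x' by (rule limitin_topspace)
  then obtain n where n: "n \<in> A" "a n x' \<in> U"
    using contracting_pointD [OF a _ U] by blast
  then have "f (a n x') = g (a n x')"
    using f(2) g(2) x'X eq by simp
  then show False
    using n VW by (auto simp: U_def disjnt_iff)
qed

text \<open>
  With \<open>c t\<close> the action of \<open>t\<^sup>-\<^sup>1\<close> for \<open>t\<close> in a transversal, this is the passage to a subgroup of finite
  index: if \<open>g = h t\<close> moves \<open>t\<^sup>-\<^sup>1 x\<close> into \<open>U\<close>, then \<open>h\<close> moves \<open>x\<close> into \<open>U\<close>.
\<close>

lemma contracting_finite_cover:
  assumes a: "contracting A X a" and T: "finite T"
    and c: "\<And>t x. t \<in> T \<Longrightarrow> x \<in> topspace X \<Longrightarrow> c t x \<in> topspace X"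
    and cover: "\<And>g. g \<in> A \<Longrightarrow> \<exists>t\<in>T. \<exists>h\<in>B. \<forall>x\<in>topspace X. a g (c t x) = b h x"
  shows "contracting B X b"
  unfolding contracting_def
proof (intro allI impI, elim conjE)
  fix S U assume S: "finite S" "S \<subseteq> topspace X" and U: "openin X U" "U \<noteq> {}"
  define S' where "S' = (\<Union>t\<in>T. c t ` S)"
  have "finite S'" "S' \<subseteq> topspace X"
    using S T c by (auto simp: S'_def)
  from contractingD [OF a this U] obtain g where g: "g \<in> A" "\<forall>x\<in>S'. a g x \<in> U"
    by blast
  from cover [OF g(1)] obtain t h
    where th: "t \<in> T" "h \<in> B" "\<forall>x\<in>topspace X. a g (c t x) = b h x"
    by blast
  have "b h x \<in> U" if "x \<in> S" for x
    using th(3) [rule_format, of x] that S(2) g(2) th(1) by (force simp: S'_def)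
  then show "\<exists>h\<in>B. \<forall>x\<in>S. b h x \<in> U"
    using th(2) by blast
qed

section \<open>Minimal subspaces of proximal spaces\<close>

lemma compact_space_INT_nonempty:
  assumes X: "compact_space X" and C: "\<And>i. i \<in> I \<Longrightarrow> closedin X (C i)"
    and fin: "\<And>S. finite S \<Longrightarrow> S \<subseteq> I \<Longrightarrow> \<Inter> (C ` S) \<noteq> {}"
  shows "\<Inter> (C ` I) \<noteq> {}"
proof -
  have "\<Inter> \<F> \<noteq> {}" if \<F>: "finite \<F>" "\<F> \<subseteq> C ` I" for \<F>
  proof -
    from finite_subset_image [OF \<F>] obtain S where "S \<subseteq> I" "finite S" "\<F> = C ` S"
      by blast
    then show ?thesis using fin by simp
  qed
  then show ?thesis
    using X [unfolded compact_space_fip, rule_format, of "C ` I"] C by simp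
qed

section \<open>Orbit closures and proximal pairs\<close>

context homeo_action
begin

definition orbit_closure :: "'x \<Rightarrow> 'x set" where
  "orbit_closure x = Abstract_Topology.closure_of X ((\<lambda>g. \<phi> g x) ` carrier G)"

lemma closedin_orbit_closure: "closedin X (orbit_closure x)"
  by (simp add: orbit_closure_def)

lemma orbit_closure_subset_topspace: "orbit_closure x \<subseteq> topspace X"
  by (simp add: orbit_closure_def closure_of_subset_topspace)

lemma in_orbit_closure:
  "y \<in> orbit_closure x \<longleftrightarrow>
    y \<in> topspace X \<and> (\<forall>U. openin X U \<and> y \<in> U \<longrightarrow> (\<exists>g\<in>carrier G. \<phi> g x \<in> U))"
  by (auto simp: orbit_closure_def in_closure_of)

lemma orbit_closure_self: "x \<in> topspace X \<Longrightarrow> x \<in> orbit_closure x"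
  by (metis action_one in_orbit_closure one_closed)

lemma orbit_closure_invariant:
  assumes h: "h \<in> carrier G" and x: "x \<in> topspace X" and y: "y \<in> orbit_closure x"
  shows "\<phi> h y \<in> orbit_closure x"
  unfolding in_orbit_closure
proof (intro conjI allI impI)
  show "\<phi> h y \<in> topspace X"
    using h y orbit_closure_subset_topspace [of x] by (meson action_closed subsetD)
  fix U assume U: "openin X U \<and> \<phi> h y \<in> U"
  then have "openin X {u \<in> topspace X. \<phi> h u \<in> U}" "y \<in> {u \<in> topspace X. \<phi> h u \<in> U}"
    using h y orbit_closure_subset_topspace [of x] openin_action_preimage by auto
  then obtain g where "g \<in> carrier G" "\<phi> h (\<phi> g x) \<in> U"
    using y unfolding in_orbit_closure by blast
  then show "\<exists>g\<in>carrier G. \<phi> g x \<in> U"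
    using h x by (intro bexI [of _ "h \<otimes> g"]) (auto simp: action_mult)
qed

lemma orbit_closure_least:
  assumes "closedin X C" "\<And>g. g \<in> carrier G \<Longrightarrow> \<phi> g x \<in> C"
  shows "orbit_closure x \<subseteq> C"
  unfolding orbit_closure_def using assms by (intro closure_of_minimal) auto

lemma action_by_homeos_subtopology:
  assumes M: "M \<subseteq> topspace X" and inv: "\<And>g x. g \<in> carrier G \<Longrightarrow> x \<in> M \<Longrightarrow> \<phi> g x \<in> M"
  shows "action_by_homeos G (subtopology X M) (\<lambda>g. restrict (\<phi> g) M)"
proof (rule action_by_homeosI [OF is_group])
  have top: "topspace (subtopology X M) = M"
    using M by auto
  fix g assume g: "g \<in> carrier G"
  show "restrict (\<phi> g) M \<in> extensional (topspace (subtopology X M))"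
    unfolding top by (rule restrict_extensional)
  show "continuous_map (subtopology X M) (subtopology X M) (restrict (\<phi> g) M)"
  proof (rule continuous_map_eq)
    show "continuous_map (subtopology X M) (subtopology X M) (\<phi> g)"
      using g inv top
      by (intro continuous_map_into_subtopology continuous_map_from_subtopology action_continuous)
        auto
  qed (use top in auto)
qed (use M inv in \<open>auto simp: action_mult\<close>)

text \<open>Proximality by neighbourhoods: the orbit closure of \<open>(x, y)\<close> under the
  diagonal action contains some \<open>(z, z)\<close>.
  \<open>filter_limits_from_neighbourhoods\<close> leads back to filters.\<close>

definition proximal_pair :: "'x \<Rightarrow> 'x \<Rightarrow> bool" where
  "proximal_pair x y \<longleftrightarrow> (\<exists>z\<in>topspace X. \<forall>U. openin X U \<and> z \<in> U \<longrightarrow>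
     (\<exists>g\<in>carrier G. \<phi> g x \<in> U \<and> \<phi> g y \<in> U))"

text \<open>Serves to pass from the coinduced space, for which only proximality is established, to a
  space within the scope of the universal property.\<close>

lemma minimal_proximal_subspace_exists:
  assumes X: "topspace X \<noteq> {}" "compact_space X" "Hausdorff_space X"
    and prox: "\<And>x y. x \<in> topspace X \<Longrightarrow> y \<in> topspace X \<Longrightarrow> proximal_pair x y"
  obtains M where "M \<subseteq> topspace X"
    "minimal_proximal_space G (subtopology X M) (\<lambda>g. restrict (\<phi> g) M)"
proof -
  define I where "I C \<longleftrightarrow> closedin X C \<and> C \<noteq> {} \<and> (\<forall>g\<in>carrier G. \<forall>x\<in>C. \<phi> g x \<in> C)" for C
  have Int: "I (C \<inter> D)" if I: "I C" "I D" for C D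
  proof -
    have CD: "closedin X C" "closedin X D" "C \<subseteq> topspace X" "D \<subseteq> topspace X"
      using that closedin_subset by (auto simp: I_def)
    obtain x y where xy: "x \<in> C" "y \<in> D"
      using I by (auto simp: I_def)
    have "proximal_pair x y"
      by (rule prox) (use xy CD in auto)
    then obtain z where z: "z \<in> topspace X"
      "\<And>U. openin X U \<Longrightarrow> z \<in> U \<Longrightarrow> \<exists>g\<in>carrier G. \<phi> g x \<in> U \<and> \<phi> g y \<in> U"
      unfolding proximal_pair_def by blast
    \<comment> \<open>The point where a proximal pair meets lies in both orbit closures, hence in
      both closed invariant sets.\<close>
    then have "z \<in> orbit_closure x" "z \<in> orbit_closure y"
      unfolding in_orbit_closure by blast+
    moreover have "orbit_closure x \<subseteq> C" "orbit_closure y \<subseteq> D"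
      using orbit_closure_least [OF CD(1), of x] orbit_closure_least [OF CD(2), of y] that xy
      by (auto simp: I_def)
    ultimately show ?thesis
      using I by (auto simp: I_def)
  qed
  have I_orbit: "I (orbit_closure x)" if "x \<in> topspace X" for x
    using that closedin_orbit_closure orbit_closure_self [of x] orbit_closure_invariant
    by (auto simp: I_def)
  have fin: "I (\<Inter> (orbit_closure ` S))" if "finite S" "S \<noteq> {}" "S \<subseteq> topspace X" for S
    using that by (induction S rule: finite_ne_induct) (auto simp: I_orbit Int)
  \<comment> \<open>By proximality closed invariant sets intersect, so there is a smallest non-empty one.\<close>
  define M where "M = \<Inter> (orbit_closure ` topspace X)"
  have MX: "M \<subseteq> topspace X" and M: "closedin X M"
    using X(1) orbit_closure_subset_topspace closedin_orbit_closure
    by (fastforce simp: M_def)+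
  have "M \<noteq> {}"
  proof -
    have "\<Inter> (orbit_closure ` S) \<noteq> {}" if "finite S" "S \<subseteq> topspace X" for S
      using fin [of S] that by (cases "S = {}") (auto simp: I_def)
    then show ?thesis
      unfolding M_def by (rule compact_space_INT_nonempty [OF X(2) closedin_orbit_closure])
  qed
  have inv: "\<phi> g x \<in> M" if "g \<in> carrier G" "x \<in> M" for g x
    using that orbit_closure_invariant by (auto simp: M_def)
  let ?M = "subtopology X M" and ?\<phi> = "\<lambda>g. restrict (\<phi> g) M"
  have top: "topspace ?M = M"
    using MX by auto
  have "minimal_action G ?M ?\<phi>"
    unfolding minimal_action_def top
  proof (intro allI impI, elim conjE)
    fix C assume C: "closedin ?M C" "\<forall>g\<in>carrier G. ?\<phi> g ` C \<subseteq> C"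
    then have CM: "C \<subseteq> M"
      using closedin_subset top by metis
    have "closedin X C"
      using C(1) M by (rule closedin_trans_full)
    have "M \<subseteq> C" if x: "x \<in> C" for x
    proof -
      have "\<phi> g x \<in> C" if "g \<in> carrier G" for g
        using C(2) that x CM by fastforce
      then have "orbit_closure x \<subseteq> C"
        using orbit_closure_least \<open>closedin X C\<close> by blast
      moreover have "x \<in> topspace X"
        using x CM MX by blast
      then have "M \<subseteq> orbit_closure x"
        by (auto simp: M_def)
      ultimately show ?thesis by blast
    qed
    then show "C = {} \<or> C = M"
      using CM by blast
  qed
  moreover have "proximal_action G ?M ?\<phi>"
    unfolding proximal_action_def top
  proof (intro ballI)
    fix x y assume xy: "x \<in> M" "y \<in> M"
    have "proximal_pair x y"
      by (rule prox) (use xy MX in auto)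
    then obtain z where z: "z \<in> topspace X"
      "\<And>U. openin X U \<Longrightarrow> z \<in> U \<Longrightarrow> \<exists>g\<in>carrier G. \<phi> g x \<in> U \<and> \<phi> g y \<in> U"
      unfolding proximal_pair_def by blast
    \<comment> \<open>The meeting point stays in \<open>M\<close>, so \<open>M\<close> is proximal
      in its own right.\<close>
    then have "z \<in> orbit_closure x"
      unfolding in_orbit_closure by blast
    then have zM: "z \<in> M"
      using orbit_closure_least [OF M, of x] inv xy by blast
    have "\<exists>g\<in>carrier G. \<forall>u\<in>{x, y}. ?\<phi> g u \<in> U" if U: "openin ?M U" "z \<in> U" for U
    proof -
      obtain V where V: "openin X V" "U = V \<inter> M"
        using U unfolding openin_subtopology by blast
      then obtain g where "g \<in> carrier G" "\<phi> g x \<in> V" "\<phi> g y \<in> V"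
        using z \<open>z \<in> U\<close> by blast
      then show ?thesis
        using V inv xy by (intro bexI [of _ g]) auto
    qed
    then obtain F where F: "F \<noteq> bot" "\<forall>\<^sub>F g in F. g \<in> carrier G"
      "\<And>u. u \<in> {x, y} \<Longrightarrow> limitin ?M (\<lambda>g. ?\<phi> g u) z F"
      using filter_limits_from_neighbourhoods [of z ?M "carrier G" "{x, y}" ?\<phi>] zM top by blast
    show "\<exists>F z. F \<noteq> bot \<and> (\<forall>\<^sub>F g in F. g \<in> carrier G) \<and>
        limitin ?M (\<lambda>g. ?\<phi> g x) z F \<and> limitin ?M (\<lambda>g. ?\<phi> g y) z F"
      using F(1,2) F(3) [of x] F(3) [of y] by (intro exI [of _ F] exI [of _ z]) simp
  qed
  moreover have "action_by_homeos G ?M ?\<phi>"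
    using MX inv by (rule action_by_homeos_subtopology)
  moreover have "compact_space ?M"
    using closedin_compact_space [OF X(2) M] by (rule compact_space_subtopology)
  ultimately have "minimal_proximal_space G ?M ?\<phi>"
    using X(3) \<open>M \<noteq> {}\<close> top by (simp add: minimal_proximal_space_def Hausdorff_space_subtopology)
  then show thesis
    using that MX by blast
qed

end

lemma (in homeo_action) action_by_homeos_prod_topology:
  "action_by_homeos G (prod_topology X X)
     (\<lambda>g. restrict (map_prod (\<phi> g) (\<phi> g)) (topspace (prod_topology X X)))"
proof (rule action_by_homeosI [OF is_group])
  fix g assume g: "g \<in> carrier G"
  have "continuous_map (prod_topology X X) (prod_topology X X) (\<lambda>p. (\<phi> g (fst p), \<phi> g (snd p)))"
    using continuous_map_compose [OF continuous_map_fst action_continuous [OF g], of X]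
      continuous_map_compose [OF continuous_map_snd action_continuous [OF g], of X]
    by (simp add: continuous_map_paired o_def)
  then show "continuous_map (prod_topology X X) (prod_topology X X)
      (restrict (map_prod (\<phi> g) (\<phi> g)) (topspace (prod_topology X X)))"
    by (rule continuous_map_eq) (auto simp: map_prod_def)
qed (auto simp: action_mult)

section \<open>Commensurated subgroups\<close>

locale commensurated_subgroup = group G for G (structure) +
  fixes L
  assumes comm: "commensurated G L"
begin

definition conjugate :: "'a \<Rightarrow> 'a \<Rightarrow> 'a" where
  "conjugate s h = s \<otimes> h \<otimes> inv s"

text \<open>The intersection of \<open>L\<close> with all \<open>inv f <# L #> f\<close> for
  \<open>f\<close> in \<open>F\<close>; for finite \<open>F\<close> commensuration gives it finite
  index in \<open>L\<close>.\<close>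

definition conj_into :: "'a set \<Rightarrow> 'a set" where
  "conj_into F = {h \<in> L. \<forall>f\<in>F. conjugate f h \<in> L}"

lemma subgroup_L: "subgroup L G"
  using comm by (simp add: commensurated_def)

lemma L_carrier [simp]: "h \<in> L \<Longrightarrow> h \<in> carrier G"
  by (rule subgroup.mem_carrier [OF subgroup_L])

lemma L_mult [simp]: "h \<in> L \<Longrightarrow> k \<in> L \<Longrightarrow> h \<otimes> k \<in> L"
  by (rule subgroup.m_closed [OF subgroup_L])

lemma L_one [simp]: "\<one> \<in> L"
  by (rule subgroup.one_closed [OF subgroup_L])

lemma L_inv [simp]: "h \<in> L \<Longrightarrow> inv h \<in> L"
  by (rule subgroup.m_inv_closed [OF subgroup_L])

lemma conj_into_L: "h \<in> conj_into F \<Longrightarrow> h \<in> L"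
  by (simp add: conj_into_def)

lemma conjugate_mult_right:
  "s \<in> carrier G \<Longrightarrow> h \<in> carrier G \<Longrightarrow> conjugate s h \<otimes> s = s \<otimes> h"
  by (simp add: conjugate_def m_assoc)

lemma conjugate_conjugate:
  "s \<in> carrier G \<Longrightarrow> t \<in> carrier G \<Longrightarrow> h \<in> carrier G \<Longrightarrow>
    conjugate s (conjugate t h) = conjugate (s \<otimes> t) h"
  by (simp add: conjugate_def m_assoc inv_mult_group)

lemma conjugate_closed [simp]:
  "s \<in> carrier G \<Longrightarrow> h \<in> carrier G \<Longrightarrow> conjugate s h \<in> carrier G"
  by (simp add: conjugate_def)

lemma conjugate_one_left [simp]: "h \<in> carrier G \<Longrightarrow> conjugate \<one> h = h"
  by (simp add: conjugate_def)

lemma conjugate_one_right [simp]: "s \<in> carrier G \<Longrightarrow> conjugate s \<one> = \<one>"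
  by (simp add: conjugate_def)

lemma conjugate_eq_iff:
  assumes "s \<in> carrier G" "h \<in> carrier G"
  shows "conjugate s h = h \<longleftrightarrow> s \<otimes> h = h \<otimes> s"
proof
  assume "conjugate s h = h"
  then show "s \<otimes> h = h \<otimes> s"
    using conjugate_mult_right [OF assms] by simp
next
  assume "s \<otimes> h = h \<otimes> s"
  then show "conjugate s h = h"
    using assms by (simp add: conjugate_def m_assoc)
qed

lemma Int_conjugate_eq:
  assumes s: "s \<in> carrier G"
  shows "L \<inter> (inv s <# L #> s) = conj_into {s}"
proof -
  have "h \<in> inv s <# L #> s \<longleftrightarrow> conjugate s h \<in> L" if h: "h \<in> L" for h
  proof
    assume "h \<in> inv s <# L #> s"
    then obtain k where k: "k \<in> L" "h = inv s \<otimes> k \<otimes> s"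
      by (auto simp: l_coset_def r_coset_def)
    have "conjugate s h = conjugate (s \<otimes> inv s) k"
      using s k conjugate_conjugate [of s "inv s" k] by (simp add: conjugate_def)
    then show "conjugate s h \<in> L"
      using s k by simp
  next
    assume *: "conjugate s h \<in> L"
    have "h = conjugate (inv s) (conjugate s h)"
      using s h by (simp add: conjugate_conjugate)
    then have "h = inv s \<otimes> conjugate s h \<otimes> s"
      using s by (simp add: conjugate_def)
    then show "h \<in> inv s <# L #> s"
      using * by (auto simp: l_coset_def r_coset_def)
  qed
  then show ?thesis
    by (auto simp: conj_into_def)
qed

text \<open>For each \<open>f\<close> there are finitely many cosets of
  \<open>conj_into {f}\<close>. Elements of \<open>L\<close> with the same tuple of cosets differ by
  a member of \<open>conj_into F\<close>, so one representative per tuple suffices.\<close>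

lemma finite_index_conj_into:
  assumes F: "finite F" "F \<subseteq> carrier G"
  obtains T where "finite T" "T \<subseteq> L" "\<And>h. h \<in> L \<Longrightarrow> \<exists>t\<in>T. h \<otimes> inv t \<in> conj_into F"
proof -
  define c where "c h = restrict (\<lambda>f. conj_into {f} #> h) F" for h
  have "finite ((\<lambda>h. conj_into {f} #> h) ` L)" if f: "f \<in> F" for f
  proof -
    \<comment> \<open>Commensuration is applied to \<open>inv f\<close>, since
      \<open>conj_into {f}\<close> comes from the conjugate of \<open>L\<close> by
      \<open>inv f\<close>.\<close>
    have "inv f \<in> carrier G" and inv: "inv (inv f) = f"
      using f F by auto
    then have "finite (rcosets\<^bsub>G\<lparr>carrier := L\<rparr>\<^esub> (L \<inter> (inv f <# L #> inv (inv f))))"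
      using comm unfolding commensurated_def by blast
    then have "finite (rcosets\<^bsub>G\<lparr>carrier := L\<rparr>\<^esub> (conj_into {f}))"
      using f F Int_conjugate_eq [of f] inv by auto
    moreover have "rcosets\<^bsub>G\<lparr>carrier := L\<rparr>\<^esub> (conj_into {f}) = (\<lambda>h. conj_into {f} #> h) ` L"
      by (auto simp: RCOSETS_def r_coset_def)
    ultimately show ?thesis by simp
  qed
  then have "finite (\<Pi>\<^sub>E f\<in>F. (\<lambda>h. conj_into {f} #> h) ` L)"
    by (intro finite_PiE F)
  moreover have "c ` L \<subseteq> (\<Pi>\<^sub>E f\<in>F. (\<lambda>h. conj_into {f} #> h) ` L)"
    by (auto simp: c_def)
  ultimately have "finite (c ` L)"
    by (rule finite_subset [rotated])
  then obtain T where T: "T \<subseteq> L" "finite T" "c ` L = c ` T"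
    using finite_subset_image [of "c ` L" c L] by auto
  have "\<exists>t\<in>T. h \<otimes> inv t \<in> conj_into F" if h: "h \<in> L" for h
  proof -
    obtain t where t: "t \<in> T" "c h = c t"
      using T(3) h by (metis imageE imageI)
    then have tL: "t \<in> L" using T by auto
    have "conjugate f (h \<otimes> inv t) \<in> L" if f: "f \<in> F" for f
    proof -
      have fG: "f \<in> carrier G" using f F by auto
      have "conj_into {f} #> h = conj_into {f} #> t"
        using fun_cong [OF t(2), of f] f by (simp add: c_def)
      moreover have "h \<in> conj_into {f} #> h"
        using h fG by (auto simp: r_coset_def conj_into_def intro!: bexI [of _ \<one>])
      ultimately obtain k where "k \<in> conj_into {f}" "h = k \<otimes> t"
        by (auto simp: r_coset_def)
      then show ?thesis
        using tL by (simp add: conj_into_def m_assoc)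
    qed
    then have "h \<otimes> inv t \<in> conj_into F"
      using h tL by (simp add: conj_into_def)
    with t(1) show ?thesis by blast
  qed
  then show thesis
    using that T by blast
qed

end

section \<open>Contraction and rigidity for finite-index subgroups\<close>

locale commensurated_boundary = commensurated_subgroup +
  fixes X :: "'x topology" and \<phi> :: "'a \<Rightarrow> 'x \<Rightarrow> 'x"
  assumes boundary: "minimal_proximal_space (G\<lparr>carrier := L\<rparr>) X \<phi>"
begin

sublocale Lam: homeo_action "G\<lparr>carrier := L\<rparr>" X \<phi>
  using boundary by (simp add: homeo_action_def minimal_proximal_space_def)

lemma X_nonempty: "topspace X \<noteq> {}"
  and X_compact: "compact_space X"
  and X_Hausdorff: "Hausdorff_space X"
  using boundary by (simp_all add: minimal_proximal_space_def)

lemma act_closed [simp]: "h \<in> L \<Longrightarrow> x \<in> topspace X \<Longrightarrow> \<phi> h x \<in> topspace X"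
  using Lam.action_closed by simp

lemma act_one [simp]: "x \<in> topspace X \<Longrightarrow> \<phi> \<one> x = x"
  using Lam.action_one by simp

lemma act_mult: "h \<in> L \<Longrightarrow> k \<in> L \<Longrightarrow> x \<in> topspace X \<Longrightarrow> \<phi> (h \<otimes> k) x = \<phi> h (\<phi> k x)"
  using Lam.action_mult by simp

lemma act_continuous: "h \<in> L \<Longrightarrow> continuous_map X X (\<phi> h)"
  using Lam.action_continuous by simp

text \<open>Every \<open>h\<close> in \<open>L\<close> is a member of \<open>conj_into F\<close>
  times some \<open>t\<close> in the finite set \<open>T\<close>; applying \<open>inv t\<close> to
  the points beforehand absorbs that factor.\<close>

lemma contracting_conj_into:
  assumes F: "finite F" "F \<subseteq> carrier G"
  shows "contracting (conj_into F) X \<phi>"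
proof -
  obtain T where T: "finite T" "T \<subseteq> L" "\<And>h. h \<in> L \<Longrightarrow> \<exists>t\<in>T. h \<otimes> inv t \<in> conj_into F"
    using finite_index_conj_into [OF F] by blast
  have "contracting L X \<phi>"
    using minimal_proximal_space_contracting [OF boundary] by simp
  then show ?thesis
  proof (rule contracting_finite_cover [OF _ T(1)])
    show "\<phi> (inv t) x \<in> topspace X" if "t \<in> T" "x \<in> topspace X" for t x
      using that T by auto
    fix h assume h: "h \<in> L"
    then obtain t where t: "t \<in> T" "h \<otimes> inv t \<in> conj_into F"
      using T by blast
    then have "\<forall>x\<in>topspace X. \<phi> h (\<phi> (inv t) x) = \<phi> (h \<otimes> inv t) x"
      using h T act_mult by auto
    then show "\<exists>t\<in>T. \<exists>k\<in>conj_into F. \<forall>x\<in>topspace X. \<phi> h (\<phi> (inv t) x) = \<phi> k x"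
      using t by blast
  qed
qed

text \<open>The elements \<open>conjugate s h\<close> include a whole set
  \<open>conj_into F'\<close>, to which the untwisted contraction applies.\<close>

lemma contracting_conjugate:
  assumes F: "finite F" "F \<subseteq> carrier G" and s: "s \<in> F"
  shows "contracting (conj_into F) X (\<lambda>h. \<phi> (conjugate s h))"
proof -
  have sG: "s \<in> carrier G" using s F by auto
  \<comment> \<open>For \<open>k\<close> in \<open>conj_into F'\<close>, the entry
    \<open>inv s\<close> puts \<open>h = conjugate (inv s) k\<close> into \<open>L\<close>, and the
    entries \<open>f \<otimes> inv s\<close> put each \<open>conjugate f h\<close> into
    \<open>L\<close>.\<close>
  define F' where "F' = insert (inv s) ((\<lambda>f. f \<otimes> inv s) ` F)"
  have "finite F'" "F' \<subseteq> carrier G"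
    using F sG by (auto simp: F'_def)
  then have con: "contracting (conj_into F') X \<phi>"
    by (rule contracting_conj_into)
  have *: "conjugate (inv s) k \<in> conj_into F \<and> conjugate s (conjugate (inv s) k) = k"
    if k: "k \<in> conj_into F'" for k
  proof -
    have kL: "k \<in> L" and "conjugate (inv s) k \<in> L"
      and "\<And>f. f \<in> F \<Longrightarrow> conjugate (f \<otimes> inv s) k \<in> L"
      using k by (auto simp: conj_into_def F'_def)
    moreover have "conjugate f (conjugate (inv s) k) = conjugate (f \<otimes> inv s) k" if "f \<in> F" for f
      using that F sG kL by (intro conjugate_conjugate) auto
    ultimately show ?thesis
      using sG by (auto simp: conj_into_def conjugate_conjugate)
  qed
  show ?thesis
    unfolding contracting_def
  proof (intro allI impI, elim conjE)
    fix S U assume "finite S" "S \<subseteq> topspace X" "openin X U" "U \<noteq> {}"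
    from contractingD [OF con this] obtain k where "k \<in> conj_into F'" "\<forall>x\<in>S. \<phi> k x \<in> U"
      by blast
    then show "\<exists>h\<in>conj_into F. \<forall>x\<in>S. \<phi> (conjugate s h) x \<in> U"
      using * by (metis (no_types, lifting))
  qed
qed

text \<open>The rigidity behind all later identities between maps: contraction holds untwisted on
  the domain and twisted on the codomain. Letting \<open>F\<close> contain more than
  \<open>s\<close> makes room for compositions.\<close>

lemma conjugate_equivariant_unique:
  assumes F: "finite F" "F \<subseteq> carrier G" and s: "s \<in> F"
    and f: "continuous_map X X f"
      "\<And>h x. h \<in> conj_into F \<Longrightarrow> x \<in> topspace X \<Longrightarrow> f (\<phi> h x) = \<phi> (conjugate s h) (f x)"
    and g: "continuous_map X X g"
      "\<And>h x. h \<in> conj_into F \<Longrightarrow> x \<in> topspace X \<Longrightarrow> g (\<phi> h x) = \<phi> (conjugate s h) (g x)"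
    and x: "x \<in> topspace X"
  shows "f x = g x"
proof (rule contracting_equivariant_unique [where A = "conj_into F" and a = \<phi> and X = X
      and b = "\<lambda>h. \<phi> (conjugate s h)" and Y = X and f = f and g = g])
  show "contracting (conj_into F) X \<phi>"
    using F by (rule contracting_conj_into)
  show "contracting (conj_into F) X (\<lambda>h. \<phi> (conjugate s h))"
    using F s by (rule contracting_conjugate)
  show "\<phi> h x \<in> topspace X" if "h \<in> conj_into F" "x \<in> topspace X" for h x
    using that conj_into_L by simp
qed (fact X_compact X_Hausdorff f g x)+

end

section \<open>The coinduced space\<close>

context commensurated_boundary
begin

definition coinduced_set :: "('a \<Rightarrow> 'x) set" where
  "coinduced_set = {f \<in> carrier G \<rightarrow>\<^sub>E topspace X.
     \<forall>h\<in>L. \<forall>g\<in>carrier G. f (h \<otimes> g) = \<phi> h (f g)}"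

definition coinduced_space :: "('a \<Rightarrow> 'x) topology" where
  "coinduced_space = subtopology (product_topology (\<lambda>_. X) (carrier G)) coinduced_set"

text \<open>The outer restriction is what \<open>group_action\<close> asks for; the inner one keeps
  the values extensional on \<open>carrier G\<close>.\<close>

definition translate :: "'a \<Rightarrow> ('a \<Rightarrow> 'x) \<Rightarrow> 'a \<Rightarrow> 'x" where
  "translate k = (\<lambda>f\<in>coinduced_set. \<lambda>g\<in>carrier G. f (g \<otimes> k))"

lemma topspace_coinduced [simp]: "topspace coinduced_space = coinduced_set"
  by (auto simp: coinduced_space_def coinduced_set_def)

lemma coinduced_closed: "f \<in> coinduced_set \<Longrightarrow> g \<in> carrier G \<Longrightarrow> f g \<in> topspace X"
  by (auto simp: coinduced_set_def)

lemma coinduced_equivariant: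
  "f \<in> coinduced_set \<Longrightarrow> h \<in> L \<Longrightarrow> g \<in> carrier G \<Longrightarrow> f (h \<otimes> g) = \<phi> h (f g)"
  by (auto simp: coinduced_set_def)

lemma coinduced_extensional: "f \<in> coinduced_set \<Longrightarrow> f \<in> extensional (carrier G)"
  by (auto simp: coinduced_set_def PiE_def)

lemma coinduced_eval_continuous:
  "g \<in> carrier G \<Longrightarrow> continuous_map coinduced_space X (\<lambda>f. f g)"
  unfolding coinduced_space_def
  by (intro continuous_map_from_subtopology continuous_map_product_projection)

text \<open>An equivariant function may be prescribed freely on one representative of each coset
  \<open>L #> g\<close>; here all these values are \<open>x\<close>.\<close>

lemma coinduced_nonempty: "coinduced_set \<noteq> {}"
proof -
  obtain x where x: "x \<in> topspace X" using X_nonempty by blast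
  \<comment> \<open>The choice depends on the coset only, so \<open>r\<close> is constant on
    it.\<close>
  define r where "r g = (SOME r. r \<in> L #> g)" for g
  have r: "r g \<in> carrier G \<and> g \<otimes> inv (r g) \<in> L" if g: "g \<in> carrier G" for g
  proof -
    have "r g \<in> L #> g"
      unfolding r_def using rcos_self [OF g subgroup_L] by (rule someI)
    then obtain k where k: "k \<in> L" "r g = k \<otimes> g"
      by (auto simp: r_coset_def)
    then have "g \<otimes> inv (r g) = inv k"
      using g by (simp add: inv_mult_group flip: m_assoc)
    then show ?thesis using k g by simp
  qed
  have r_eq: "r (h \<otimes> g) = r g" if "h \<in> L" "g \<in> carrier G" for h g
  proof -
    have "L #> (h \<otimes> g) = L #> g"
      using that subgroup_L by (intro repr_independence [symmetric]) (auto simp: r_coset_def)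
    then show ?thesis by (simp add: r_def)
  qed
  have "(\<lambda>g\<in>carrier G. \<phi> (g \<otimes> inv (r g)) x) \<in> coinduced_set"
    unfolding coinduced_set_def
  proof (intro CollectI conjI ballI)
    fix h g assume hg: "h \<in> L" "g \<in> carrier G"
    then have "h \<otimes> g \<otimes> inv (r (h \<otimes> g)) = h \<otimes> (g \<otimes> inv (r g))"
      using r r_eq by (simp add: m_assoc)
    then show "(\<lambda>g\<in>carrier G. \<phi> (g \<otimes> inv (r g)) x) (h \<otimes> g) =
        \<phi> h ((\<lambda>g\<in>carrier G. \<phi> (g \<otimes> inv (r g)) x) g)"
      using hg r x by (simp add: act_mult)
  qed (use r x in auto)
  then show ?thesis by blast
qed

lemma coinduced_Hausdorff: "Hausdorff_space coinduced_space"
  unfolding coinduced_space_def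
  by (intro Hausdorff_space_subtopology) (simp add: Hausdorff_space_product_topology X_Hausdorff)

text \<open>Equivariance is a family of equations between continuous maps into a Hausdorff space, so
  it cuts a closed set out of a compact product.\<close>

lemma coinduced_compact: "compact_space coinduced_space"
proof -
  let ?P = "product_topology (\<lambda>_. X) (carrier G)"
  have eq: "coinduced_set = {f \<in> topspace ?P. \<forall>h\<in>L. \<forall>g\<in>carrier G. f (h \<otimes> g) = \<phi> h (f g)}"
    by (simp add: coinduced_set_def)
  have "coinduced_set = (\<Inter>h\<in>L. \<Inter>g\<in>carrier G. {f \<in> topspace ?P. f (h \<otimes> g) = \<phi> h (f g)})"
    unfolding eq using L_one one_closed by blast
  also have "closedin ?P \<dots>"
  proof (intro closedin_INT)
    show "closedin ?P {f \<in> topspace ?P. f (h \<otimes> g) = \<phi> h (f g)}"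
      if hg: "h \<in> L" "g \<in> carrier G" for h g
    proof (rule closedin_continuous_maps_eq [OF X_Hausdorff])
      show "continuous_map ?P X (\<lambda>f. f (h \<otimes> g))"
        using hg by (intro continuous_map_product_projection) auto
      have "continuous_map ?P X (\<phi> h \<circ> (\<lambda>f. f g))"
        using hg continuous_map_product_projection [of g "carrier G" "\<lambda>_. X"]
        by (intro continuous_map_compose [where X' = X] act_continuous)
      then show "continuous_map ?P X (\<lambda>f. \<phi> h (f g))"
        by (simp add: o_def)
    qed
  qed (use L_one one_closed in blast)+
  finally have "closedin ?P coinduced_set" .
  moreover have "compact_space ?P"
    by (simp add: compact_space_product_topology X_compact)
  ultimately show ?thesis
    unfolding coinduced_space_def by (intro compact_space_subtopology closedin_compact_space)
qed

lemma translate_apply: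
  "f \<in> coinduced_set \<Longrightarrow> g \<in> carrier G \<Longrightarrow> translate k f g = f (g \<otimes> k)"
  by (simp add: translate_def)

lemma translate_closed:
  assumes "k \<in> carrier G" "f \<in> coinduced_set"
  shows "translate k f \<in> coinduced_set"
  using assms by (auto simp: translate_def coinduced_set_def m_assoc)

lemma translate_action: "action_by_homeos (G\<lparr>carrier := L\<rparr>) coinduced_space translate"
proof (rule action_by_homeosI)
  show "group (G\<lparr>carrier := L\<rparr>)"
    by (rule Lam.is_group)
  show "translate k \<in> extensional (topspace coinduced_space)" for k
    by (simp add: translate_def)
  show "continuous_map coinduced_space coinduced_space (translate k)"
    if "k \<in> carrier (G\<lparr>carrier := L\<rparr>)" for k
  proof -
    have k: "k \<in> carrier G" using that by simp
    have "continuous_map coinduced_space X (\<lambda>f. translate k f g)" if g: "g \<in> carrier G" for g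
    proof (rule continuous_map_eq)
      show "continuous_map coinduced_space X (\<lambda>f. f (g \<otimes> k))"
        using g k by (intro coinduced_eval_continuous) auto
    qed (use g in \<open>auto simp: translate_apply\<close>)
    moreover have "translate k ` coinduced_set \<subseteq> extensional (carrier G)"
      using translate_closed [OF k] coinduced_extensional by blast
    ultimately have "continuous_map coinduced_space (product_topology (\<lambda>_. X) (carrier G)) (translate k)"
      by (simp add: continuous_map_componentwise)
    then have "continuous_map coinduced_space
        (subtopology (product_topology (\<lambda>_. X) (carrier G)) coinduced_set) (translate k)"
      using translate_closed [OF k] by (intro continuous_map_into_subtopology) auto
    then show ?thesis
      by (simp only: coinduced_space_def [symmetric])
  qed
  show "translate (k \<otimes>\<^bsub>G\<lparr>carrier := L\<rparr>\<^esub> l) f = translate k (translate l f)"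
    if "k \<in> carrier (G\<lparr>carrier := L\<rparr>)" "l \<in> carrier (G\<lparr>carrier := L\<rparr>)" "f \<in> topspace coinduced_space"
    for k l f
  proof (rule extensionalityI)
    have kl: "k \<in> L" "l \<in> L" "f \<in> coinduced_set"
      using that by auto
    then show "translate (k \<otimes>\<^bsub>G\<lparr>carrier := L\<rparr>\<^esub> l) f g = translate k (translate l f) g"
      if "g \<in> carrier G" for g
      using that by (simp add: translate_apply translate_closed m_assoc)
    show "translate (k \<otimes>\<^bsub>G\<lparr>carrier := L\<rparr>\<^esub> l) f \<in> extensional (carrier G)"
      "translate k (translate l f) \<in> extensional (carrier G)"
      using kl by (auto intro!: coinduced_extensional translate_closed)
  qed
  show "translate \<one>\<^bsub>G\<lparr>carrier := L\<rparr>\<^esub> f = f" if "f \<in> topspace coinduced_space" for f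
    by (rule extensionalityI [of _ "carrier G"])
      (use that in \<open>auto simp: translate_apply intro!: coinduced_extensional translate_closed\<close>)
qed

text \<open>Since \<open>s \<otimes> h = conjugate s h \<otimes> s\<close>, right translation by
  \<open>h\<close> is, at the coordinate \<open>s\<close>, left multiplication by an element of
  \<open>L\<close>.\<close>

lemma translate_conjugate:
  assumes "f \<in> coinduced_set" "s \<in> carrier G" "h \<in> carrier G" "conjugate s h \<in> L"
  shows "translate h f s = \<phi> (conjugate s h) (f s)"
proof -
  have "translate h f s = f (conjugate s h \<otimes> s)"
    using assms by (simp add: translate_apply conjugate_mult_right)
  then show ?thesis
    using assms by (simp add: coinduced_equivariant)
qed

sublocale coind: homeo_action "G\<lparr>carrier := L\<rparr>" coinduced_space translate
  by (simp add: homeo_action_def translate_action)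

section \<open>Proximality of the coinduced space\<close>

abbreviation pair_space :: "(('a \<Rightarrow> 'x) \<times> ('a \<Rightarrow> 'x)) topology" where
  "pair_space \<equiv> prod_topology coinduced_space coinduced_space"

definition pair_translate ::
  "'a \<Rightarrow> ('a \<Rightarrow> 'x) \<times> ('a \<Rightarrow> 'x) \<Rightarrow> ('a \<Rightarrow> 'x) \<times> ('a \<Rightarrow> 'x)" where
  "pair_translate = (\<lambda>k. restrict (map_prod (translate k) (translate k)) (topspace pair_space))"

lemma pair_translate_apply:
  "a \<in> coinduced_set \<Longrightarrow> b \<in> coinduced_set \<Longrightarrow>
    pair_translate k (a, b) = (translate k a, translate k b)"
  by (simp add: pair_translate_def)

sublocale pairs: homeo_action "G\<lparr>carrier := L\<rparr>" pair_space pair_translate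
  using coind.action_by_homeos_prod_topology
  by (simp only: homeo_action_def pair_translate_def)

lemma pair_compact: "compact_space pair_space"
  by (simp add: compact_space_prod_topology coinduced_compact)

lemma pair_eval_continuous:
  assumes "g \<in> carrier G"
  shows "continuous_map pair_space X (\<lambda>p. fst p g)" "continuous_map pair_space X (\<lambda>p. snd p g)"
  using continuous_map_compose [OF continuous_map_fst coinduced_eval_continuous [OF assms]]
    continuous_map_compose [OF continuous_map_snd coinduced_eval_continuous [OF assms]]
  by (auto simp: o_def)

lemma closedin_pairs_agree:
  "g \<in> carrier G \<Longrightarrow> closedin pair_space {p \<in> topspace pair_space. fst p g = snd p g}"
  by (intro closedin_continuous_maps_eq [OF X_Hausdorff] pair_eval_continuous)

text \<open>
  The coordinates are made to agree one after the other, using elements \<open>m\<close> with \<open>f m f\<^sup>-\<^sup>1\<close> in \<open>L\<close> for all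
  the coordinates \<open>f\<close> treated so far: those act on each such coordinate separately, and hence
  preserve the agreement already achieved.
\<close>

lemma orbit_closure_pairs_agree:
  assumes p0: "p0 \<in> topspace pair_space" and F: "finite F" "F \<subseteq> carrier G"
  shows "\<exists>p\<in>pairs.orbit_closure p0. \<forall>g\<in>F. fst p g = snd p g"
  using F
proof (induction F)
  case empty
  then show ?case using pairs.orbit_closure_self [OF p0] by blast
next
  case (insert g F)
  then have g: "g \<in> carrier G" and F: "finite (insert g F)" "insert g F \<subseteq> carrier G" by auto
  obtain a b where ab: "(a, b) \<in> pairs.orbit_closure p0" "\<And>f. f \<in> F \<Longrightarrow> a f = b f"
    using insert by fastforce
  have "(a, b) \<in> topspace pair_space"
    using ab(1) pairs.orbit_closure_subset_topspace by blast
  then have a: "a \<in> coinduced_set" and b: "b \<in> coinduced_set"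
    by auto
  let ?N = "conj_into (insert g F)"
  have ag: "a g \<in> topspace X" and bg: "b g \<in> topspace X"
    using a b g coinduced_closed by auto
  \<comment> \<open>At the coordinate \<open>g\<close>, translation by \<open>m\<close> acts as
    \<open>conjugate g m\<close>; this twisted family drives both \<open>a g\<close> and
    \<open>b g\<close> to \<open>a g\<close>.\<close>
  have "\<exists>m\<in>?N. \<forall>x\<in>{a g, b g}. \<phi> (conjugate g m) x \<in> U" if "openin X U" "a g \<in> U" for U
    using that ag bg by (intro contractingD [OF contracting_conjugate [OF F]]) auto
  then obtain \<F> where \<F>: "\<F> \<noteq> bot" "\<forall>\<^sub>F m in \<F>. m \<in> ?N"
      "\<And>x. x \<in> {a g, b g} \<Longrightarrow> limitin X (\<lambda>m. \<phi> (conjugate g m) x) (a g) \<F>"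
    using filter_limits_from_neighbourhoods [OF ag, of ?N "{a g, b g}" "\<lambda>m. \<phi> (conjugate g m)"]
    by blast
  have pair_eq: "pair_translate m (a, b) = (translate m a, translate m b)" for m
    using a b by (rule pair_translate_apply)
  have in_top: "pair_translate m (a, b) \<in> topspace pair_space" if "m \<in> ?N" for m
    using that a b conj_into_L by (auto simp: translate_closed pair_eq)
  have "\<forall>\<^sub>F m in \<F>. pair_translate m (a, b) \<in> topspace pair_space"
    using \<F>(2) by eventually_elim (rule in_top)
  \<comment> \<open>The limit \<open>p\<close> inherits the earlier agreements and membership in the
    orbit closure, as these are closed conditions.\<close>
  then obtain \<F>' p where \<F>': "\<F>' \<le> \<F>" "\<F>' \<noteq> bot"
      and p: "limitin pair_space (\<lambda>m. pair_translate m (a, b)) p \<F>'"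
    by (rule compact_space_convergent_subfilter [OF pair_compact \<F>(1)])
  have N: "\<forall>\<^sub>F m in \<F>'. m \<in> ?N"
    using \<F>(2) by (rule filter_leD [OF \<F>'(1)])
  have tr: "translate m c f = \<phi> (conjugate f m) (c f)"
    if "m \<in> ?N" "f \<in> insert g F" "c \<in> coinduced_set" for m f c
    using that F by (intro translate_conjugate) (auto simp: conj_into_def)
  have "p \<in> pairs.orbit_closure p0"
  proof (rule limitin_closedin [OF p pairs.closedin_orbit_closure])
    show "\<forall>\<^sub>F m in \<F>'. pair_translate m (a, b) \<in> pairs.orbit_closure p0"
      using N
    proof eventually_elim
      case (elim m)
      then show ?case
        using pairs.orbit_closure_invariant [OF _ p0 ab(1), of m] conj_into_L by simp
    qed
  qed (use \<F>' in simp)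
  moreover have "fst p f = snd p f" if f: "f \<in> F" for f
  proof -
    have fG: "f \<in> carrier G" using f F by auto
    have "p \<in> {p \<in> topspace pair_space. fst p f = snd p f}"
    proof (rule limitin_closedin [OF p closedin_pairs_agree [OF fG]])
      show "\<forall>\<^sub>F m in \<F>'. pair_translate m (a, b) \<in> {p \<in> topspace pair_space. fst p f = snd p f}"
        using N
      proof eventually_elim
        case (elim m)
        then show ?case
          using in_top [OF elim] tr [OF elim _ a, of f] tr [OF elim _ b, of f] ab(2) f pair_eq by auto
      qed
    qed (use \<F>' in simp)
    then show ?thesis by simp
  qed
  moreover have "fst p g = snd p g"
  proof -
    \<comment> \<open>Used for the first and the second component: both have the limit
      \<open>a g\<close> at the coordinate \<open>g\<close>.\<close>
    have lim: "e p = a g" if e: "continuous_map pair_space X e"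
      "\<And>m. m \<in> ?N \<Longrightarrow> e (pair_translate m (a, b)) = \<phi> (conjugate g m) x" "x \<in> {a g, b g}" for e x
    proof (rule limitin_Hausdorff_unique [OF _ _ _ X_Hausdorff])
      show "limitin X (e \<circ> (\<lambda>m. pair_translate m (a, b))) (e p) \<F>'"
        using e(1) p by (rule continuous_map_limit)
      have "limitin X (\<lambda>m. \<phi> (conjugate g m) x) (a g) \<F>'"
        using \<F>(3) [OF e(3)] filter_leD [OF \<F>'(1)] by (auto simp: limitin_def)
      then show "limitin X (e \<circ> (\<lambda>m. pair_translate m (a, b))) (a g) \<F>'"
        by (rule limitin_transform_eventually [rotated])
          (use N in \<open>eventually_elim, simp only: o_def e(2)\<close>)
    qed (use \<F>' in simp)
    have "fst p g = a g"
      using lim [of "\<lambda>p. fst p g" "a g"] pair_eval_continuous [OF g] tr [of _ g a] a pair_eq by simp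
    moreover have "snd p g = a g"
      using lim [of "\<lambda>p. snd p g" "b g"] pair_eval_continuous [OF g] tr [of _ g b] b pair_eq by simp
    ultimately show ?thesis by simp
  qed
  ultimately show ?case by blast
qed

text \<open>Compactness turns agreement on finite sets of coordinates into agreement on all of them,
  that is, into a diagonal point in the orbit closure of \<open>(z, z')\<close>.\<close>

lemma coinduced_proximal:
  assumes z: "z \<in> coinduced_set" "z' \<in> coinduced_set"
  shows "coind.proximal_pair z z'"
proof -
  have p0: "(z, z') \<in> topspace pair_space" using z by simp
  define C where "C g = pairs.orbit_closure (z, z') \<inter> {p \<in> topspace pair_space. fst p g = snd p g}" for g
  have "\<Inter> (C ` carrier G) \<noteq> {}"
  proof (rule compact_space_INT_nonempty [OF pair_compact])
    show "closedin pair_space (C g)" if "g \<in> carrier G" for g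
      unfolding C_def using pairs.closedin_orbit_closure closedin_pairs_agree [OF that]
      by (rule closedin_Int)
    fix S assume "finite S" "S \<subseteq> carrier G"
    then obtain p where "p \<in> pairs.orbit_closure (z, z')" "\<forall>g\<in>S. fst p g = snd p g"
      using orbit_closure_pairs_agree [OF p0] by blast
    then have "p \<in> \<Inter> (C ` S)"
      using pairs.orbit_closure_subset_topspace by (auto simp: C_def)
    then show "\<Inter> (C ` S) \<noteq> {}" by blast
  qed
  then obtain a b where ab: "\<And>g. g \<in> carrier G \<Longrightarrow> (a, b) \<in> C g"
    by auto
  then have K: "(a, b) \<in> pairs.orbit_closure (z, z')"
    using one_closed by (auto simp: C_def)
  then have a: "a \<in> coinduced_set" and b: "b \<in> coinduced_set"
    using pairs.orbit_closure_subset_topspace by auto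
  have "a = b"
    by (rule extensionalityI [of _ "carrier G"])
      (use ab a b coinduced_extensional in \<open>auto simp: C_def\<close>)
  have "\<exists>k\<in>L. translate k z \<in> U \<and> translate k z' \<in> U"
    if U: "openin coinduced_space U" "a \<in> U" for U
  proof -
    have "openin pair_space (U \<times> U)" "(a, b) \<in> U \<times> U"
      using U \<open>a = b\<close> by (auto simp: openin_prod_Times_iff)
    then obtain k where "k \<in> L" "pair_translate k (z, z') \<in> U \<times> U"
      using K unfolding pairs.in_orbit_closure by auto
    then show ?thesis using z by (auto simp: pair_translate_apply)
  qed
  then show ?thesis
    using a unfolding coind.proximal_pair_def by auto
qed

end

section \<open>Maps that intertwine conjugation\<close>

lemma (in commensurated_boundary) conjugation_equivariant_maps:
  assumes univ: "universal_minimal_proximal_space (G\<lparr>carrier := L\<rparr>) X \<phi>"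
  obtains \<Phi> where "\<And>s. s \<in> carrier G \<Longrightarrow> continuous_map X X (\<Phi> s)"
    "\<And>s h x. s \<in> carrier G \<Longrightarrow> h \<in> L \<Longrightarrow> conjugate s h \<in> L \<Longrightarrow> x \<in> topspace X \<Longrightarrow>
      \<Phi> s (\<phi> h x) = \<phi> (conjugate s h) (\<Phi> s x)"
proof -
  obtain M where M: "M \<subseteq> coinduced_set"
    and mp: "minimal_proximal_space (G\<lparr>carrier := L\<rparr>) (subtopology coinduced_space M)
      (\<lambda>k. restrict (translate k) M)"
    using coind.minimal_proximal_subspace_exists coinduced_nonempty coinduced_compact
      coinduced_Hausdorff coinduced_proximal by auto
  obtain F where F: "continuous_map X (subtopology coinduced_space M) F"
      "\<And>h x. h \<in> L \<Longrightarrow> x \<in> topspace X \<Longrightarrow> F (\<phi> h x) = restrict (translate h) M (F x)"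
    using universal_minimal_proximal_space_image [OF univ mp] unfolding equivariant_image_def by auto
  then have F': "continuous_map X coinduced_space F" and FM: "\<And>x. x \<in> topspace X \<Longrightarrow> F x \<in> M"
    by (auto simp: continuous_map_in_subtopology)
  \<comment> \<open>The maps are evaluations of \<open>F\<close> at \<open>s\<close>, where
    translation by \<open>h\<close> acts as \<open>conjugate s h\<close>. Multiplicativity in
    \<open>s\<close> comes later, from rigidity.\<close>
  show thesis
  proof (rule that [of "\<lambda>s x. F x s"])
    show "continuous_map X X (\<lambda>x. F x s)" if "s \<in> carrier G" for s
      using continuous_map_compose [OF F' coinduced_eval_continuous [OF that]] by (simp add: o_def)
    show "F (\<phi> h x) s = \<phi> (conjugate s h) (F x s)"
      if "s \<in> carrier G" "h \<in> L" "conjugate s h \<in> L" "x \<in> topspace X" for s h x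
      using that F(2) [of h x] FM [of x] M translate_conjugate [of "F x" s h] by auto
  qed
qed

section \<open>The Gleason cover\<close>

text \<open>For \<open>U\<close> inside the space this is the largest open set disjoint from
  \<open>U\<close>, the substitute for the complement among open sets.\<close>

definition exterior :: "'x topology \<Rightarrow> 'x set \<Rightarrow> 'x set" where
  "exterior X U = topspace X - X closure_of U"

lemma openin_exterior: "openin X (exterior X U)"
  by (auto simp: exterior_def)

lemma exterior_disjoint: "U \<subseteq> topspace X \<Longrightarrow> U \<inter> exterior X U = {}"
  using closure_of_subset [of U X] by (auto simp: exterior_def)

lemma disjoint_subset_exterior:
  assumes "openin X V" "V \<inter> U = {}"
  shows "V \<subseteq> exterior X U"
proof -
  have "V \<inter> X closure_of U = {}"
    using assms openin_Int_closure_of_eq_empty by metis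
  then show ?thesis
    using openin_subset [OF assms(1)] by (auto simp: exterior_def)
qed

text \<open>Each clause, for given open sets, involves finitely many values of \<open>p\<close> and
  so is a closed condition in the product of discrete spaces.\<close>

definition open_ultrafilter :: "'x topology \<Rightarrow> ('x set \<Rightarrow> bool) \<Rightarrow> bool" where
  "open_ultrafilter X p \<longleftrightarrow> \<not> p {} \<and>
     (\<forall>U V. openin X U \<longrightarrow> openin X V \<longrightarrow> p U \<longrightarrow> p V \<longrightarrow> p (U \<inter> V)) \<and>
     (\<forall>U. openin X U \<longrightarrow> p U \<or> p (exterior X U))"

lemma open_ultrafilter_Int:
  "open_ultrafilter X p \<Longrightarrow> openin X U \<Longrightarrow> openin X V \<Longrightarrow> p U \<Longrightarrow> p V \<Longrightarrow> p (U \<inter> V)"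
  by (simp add: open_ultrafilter_def)

lemma open_ultrafilter_exterior_iff:
  assumes "open_ultrafilter X p" "openin X U"
  shows "p (exterior X U) \<longleftrightarrow> \<not> p U"
proof -
  have "U \<inter> exterior X U = {}"
    using openin_subset [OF assms(2)] by (rule exterior_disjoint)
  then show ?thesis
    using open_ultrafilter_Int [OF assms(1,2) openin_exterior, of U] assms
    by (auto simp: open_ultrafilter_def)
qed

lemma open_ultrafilter_Inter:
  assumes p: "open_ultrafilter X p" and "finite \<U>" "\<U> \<noteq> {}" "\<And>U. U \<in> \<U> \<Longrightarrow> openin X U \<and> p U"
  shows "openin X (\<Inter> \<U>) \<and> p (\<Inter> \<U>)"
  using assms(2-) by (induction \<U> rule: finite_ne_induct) (auto intro: open_ultrafilter_Int [OF p])

text \<open>By maximality, a maximal intersection-closed family without \<open>{}\<close> contains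
  every open set that meets all its members, and one of \<open>U\<close> and
  \<open>exterior X U\<close> does so.\<close>

lemma open_ultrafilter_exists:
  assumes ne: "topspace X \<noteq> {}"
  obtains p where "open_ultrafilter X p"
proof -
  define \<P> where "\<P> = {M. M \<subseteq> Collect (openin X) \<and> topspace X \<in> M \<and> {} \<notin> M \<and>
    (\<forall>U\<in>M. \<forall>V\<in>M. U \<inter> V \<in> M)}"
  have "\<exists>M\<in>\<P>. \<forall>N\<in>\<P>. M \<subseteq> N \<longrightarrow> N = M"
  proof (rule subset_Zorn_nonempty)
    have "{topspace X} \<in> \<P>"
      unfolding \<P>_def using ne by blast
    then show "\<P> \<noteq> {}" by blast
    fix \<C> assume \<C>: "\<C> \<noteq> {}" "subset.chain \<P> \<C>"
    then have sub: "\<C> \<subseteq> \<P>" and total: "\<And>M N. M \<in> \<C> \<Longrightarrow> N \<in> \<C> \<Longrightarrow> M \<subseteq> N \<or> N \<subseteq> M"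
      by (auto simp: subset_chain_def)
    have "U \<inter> V \<in> \<Union> \<C>" if "U \<in> M" "V \<in> N" "M \<in> \<C>" "N \<in> \<C>" for U V M N
      using total [OF that(3,4)] sub that unfolding \<P>_def by blast
    then show "\<Union> \<C> \<in> \<P>"
      using \<C>(1) sub by (auto simp: \<P>_def)
  qed
  then obtain M where M: "M \<in> \<P>" and max: "\<And>N. N \<in> \<P> \<Longrightarrow> M \<subseteq> N \<Longrightarrow> N = M"
    by blast
  have Mop: "\<And>U. U \<in> M \<Longrightarrow> openin X U" and Mtop: "topspace X \<in> M" and Mne: "{} \<notin> M"
    and MInt: "\<And>U V. U \<in> M \<Longrightarrow> V \<in> M \<Longrightarrow> U \<inter> V \<in> M"
    using M by (auto simp: \<P>_def)
  have extend: "U \<in> M" if U: "openin X U" and meet: "\<And>V. V \<in> M \<Longrightarrow> V \<inter> U \<noteq> {}" for U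
  proof -
    \<comment> \<open>The open supersets of all \<open>V \<inter> U\<close> form an admissible
      family that contains both \<open>M\<close> and \<open>U\<close>.\<close>
    define N where "N = {W. openin X W \<and> (\<exists>V\<in>M. V \<inter> U \<subseteq> W)}"
    have "M \<subseteq> N"
      using Mop by (auto simp: N_def)
    moreover have "N \<in> \<P>"
      unfolding \<P>_def
    proof (intro CollectI conjI ballI)
      show "topspace X \<in> N" using \<open>M \<subseteq> N\<close> Mtop by blast
      show "{} \<notin> N" using meet by (auto simp: N_def)
      fix W W' assume "W \<in> N" "W' \<in> N"
      then obtain V V' where "V \<in> M" "V' \<in> M" "V \<inter> U \<subseteq> W" "V' \<inter> U \<subseteq> W'"
        and "openin X W" "openin X W'"
        by (auto simp: N_def)
      then have "V \<inter> V' \<in> M" "V \<inter> V' \<inter> U \<subseteq> W \<inter> W'" "openin X (W \<inter> W')"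
        using MInt by blast+
      then show "W \<inter> W' \<in> N"
        unfolding N_def by blast
    qed (auto simp: N_def)
    moreover have "U \<in> N"
      using U Mtop by (auto simp: N_def)
    ultimately show ?thesis
      using max by blast
  qed
  have "open_ultrafilter X (\<lambda>U. U \<in> M)"
    unfolding open_ultrafilter_def
  proof (intro conjI allI impI)
    fix U assume U: "openin X U"
    show "U \<in> M \<or> exterior X U \<in> M"
    proof (rule disjCI)
      assume "exterior X U \<notin> M"
      then obtain V where V: "V \<in> M" "V \<inter> exterior X U = {}"
        using extend [OF openin_exterior] by blast
      have "W \<inter> U \<noteq> {}" if W: "W \<in> M" for W
      proof
        assume "W \<inter> U = {}"
        then have "W \<subseteq> exterior X U"
          using disjoint_subset_exterior Mop [OF W] by metis
        then have "V \<inter> W = {}" using V by blast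
        then show False using MInt [OF V(1) W] Mne by simp
      qed
      then show "U \<in> M" using extend [OF U] by blast
    qed
  qed (use Mne MInt in auto)
  then show thesis by (rule that)
qed

text \<open>
  The limit point \<open>x\<close> of the ultrafilter \<open>p\<close> is determined by \<open>p\<close>; it is carried along so that the
  projection to \<open>X\<close> is continuous by construction. An ultrafilter is a function that is extensional
  on the open sets, so that compactness comes from Tychonoff's theorem.
\<close>

definition gleason_set :: "'x topology \<Rightarrow> ('x \<times> ('x set \<Rightarrow> bool)) set" where
  "gleason_set X = {(x, p). x \<in> topspace X \<and> p \<in> extensional (Collect (openin X)) \<and>
     open_ultrafilter X p \<and> (\<forall>U. openin X U \<longrightarrow> p U \<longrightarrow> x \<in> X closure_of U)}"

definition gleason_ambient :: "'x topology \<Rightarrow> ('x \<times> ('x set \<Rightarrow> bool)) topology" where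
  "gleason_ambient X =
     prod_topology X (product_topology (\<lambda>_. discrete_topology UNIV) (Collect (openin X)))"

definition gleason_space :: "'x topology \<Rightarrow> ('x \<times> ('x set \<Rightarrow> bool)) topology" where
  "gleason_space X = subtopology (gleason_ambient X) (gleason_set X)"

lemma topspace_gleason_ambient:
  "topspace (gleason_ambient X) = topspace X \<times> extensional (Collect (openin X))"
  by (auto simp: gleason_ambient_def PiE_def)

lemma topspace_gleason [simp]: "topspace (gleason_space X) = gleason_set X"
  by (auto simp: gleason_space_def topspace_gleason_ambient gleason_set_def)

lemma gleason_ambient_fst: "continuous_map (gleason_ambient X) X fst"
  by (simp add: gleason_ambient_def continuous_map_fst)

lemma gleason_ambient_eval:
  assumes "openin X U"
  shows "continuous_map (gleason_ambient X) (discrete_topology UNIV) (\<lambda>q. snd q U)"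
proof -
  have "continuous_map (product_topology (\<lambda>_. discrete_topology (UNIV :: bool set)) (Collect (openin X)))
      (discrete_topology UNIV) (\<lambda>p. p U)"
    using assms by (intro continuous_map_product_projection) simp
  from continuous_map_compose [OF continuous_map_snd this, of X] show ?thesis
    by (simp add: gleason_ambient_def o_def)
qed

lemma closedin_gleason_eval:
  assumes "openin X U"
  shows "closedin (gleason_ambient X) {q \<in> topspace (gleason_ambient X). snd q U \<in> B}"
  using closedin_continuous_map_preimage [OF gleason_ambient_eval [OF assms], of B] by simp

text \<open>Otherwise \<open>p\<close> holds of the exterior of \<open>U\<close>, whose closure
  misses \<open>U\<close> although it must contain \<open>x\<close>.\<close>

lemma gleason_mem_open:
  assumes xp: "(x, p) \<in> gleason_set X" and U: "openin X U" "x \<in> U"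
  shows "p U"
proof (rule ccontr)
  assume "\<not> p U"
  then have "p (exterior X U)"
    using xp U(1) by (auto simp: gleason_set_def open_ultrafilter_def)
  then have "x \<in> X closure_of (exterior X U)"
    using xp openin_exterior by (auto simp: gleason_set_def)
  moreover have "U \<inter> exterior X U = {}"
    using openin_subset [OF U(1)] by (rule exterior_disjoint)
  then have "U \<inter> X closure_of (exterior X U) = {}"
    using U(1) openin_Int_closure_of_eq_empty by metis
  ultimately show False using U(2) by blast
qed

text \<open>Evaluations take values in a discrete space, so the negated premise of an implication is
  a closed condition too, and implications become unions of closed sets.\<close>

lemma closedin_gleason_set: "closedin (gleason_ambient X) (gleason_set X)"
proof -
  let ?A = "gleason_ambient X" and ?T = "topspace (gleason_ambient X)" and ?O = "Collect (openin X)"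
  have "gleason_set X = {q \<in> ?T. snd q {} \<in> {False}} \<inter>
     (\<Inter>U\<in>?O. \<Inter>V\<in>?O. {q \<in> ?T. snd q U \<in> {False}} \<union> {q \<in> ?T. snd q V \<in> {False}} \<union>
        {q \<in> ?T. snd q (U \<inter> V) \<in> {True}}) \<inter>
     (\<Inter>U\<in>?O. {q \<in> ?T. snd q U \<in> {True}} \<union> {q \<in> ?T. snd q (exterior X U) \<in> {True}}) \<inter>
     (\<Inter>U\<in>?O. {q \<in> ?T. snd q U \<in> {False}} \<union> {q \<in> ?T. fst q \<in> X closure_of U})"
    (is "_ = ?R")
  proof (rule Set.set_eqI)
    fix q
    show "q \<in> gleason_set X \<longleftrightarrow> q \<in> ?R"
      by (cases q) (auto simp: gleason_set_def open_ultrafilter_def topspace_gleason_ambient)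
  qed
  also have "closedin ?A ?R"
  proof (intro closedin_Int closedin_INT closedin_Un closedin_gleason_eval openin_Int openin_exterior)
    show "closedin ?A {q \<in> ?T. fst q \<in> X closure_of U}" for U
      using gleason_ambient_fst closedin_closure_of by (rule closedin_continuous_map_preimage)
  qed auto
  finally show ?thesis .
qed

lemma gleason_compact: "compact_space X \<Longrightarrow> compact_space (gleason_space X)"
  unfolding gleason_space_def
  by (intro compact_space_subtopology closedin_compact_space closedin_gleason_set)
    (simp_all add: gleason_ambient_def compact_space_prod_topology compact_space_product_topology
       compact_space_discrete_topology)

lemma gleason_Hausdorff: "Hausdorff_space X \<Longrightarrow> Hausdorff_space (gleason_space X)"
  unfolding gleason_space_def gleason_ambient_def
  by (intro Hausdorff_space_subtopology)
    (simp add: Hausdorff_space_prod_topology Hausdorff_space_product_topology)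

text \<open>The closures of the members of an open ultrafilter have the finite intersection
  property, so by compactness the ultrafilter has a limit point.\<close>

lemma gleason_nonempty:
  assumes X: "topspace X \<noteq> {}" "compact_space X"
  shows "gleason_set X \<noteq> {}"
proof -
  obtain p where p: "open_ultrafilter X p"
    using open_ultrafilter_exists [OF X(1)] .
  have p_top: "p (topspace X)"
    using p open_ultrafilter_exterior_iff [OF p openin_topspace]
    by (auto simp: exterior_def closure_of_topspace open_ultrafilter_def)
  define I where "I = {U. openin X U \<and> p U}"
  have "\<Inter> ((\<lambda>U. X closure_of U) ` I) \<noteq> {}"
  proof (rule compact_space_INT_nonempty [OF X(2)])
    fix S assume S: "finite S" "S \<subseteq> I"
    \<comment> \<open>Inserting \<open>topspace X\<close> covers the case of empty
      \<open>S\<close>.\<close>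
    have "p (\<Inter> (insert (topspace X) S))"
      using open_ultrafilter_Inter [OF p, of "insert (topspace X) S"] S p_top by (auto simp: I_def)
    then obtain x where x: "x \<in> \<Inter> (insert (topspace X) S)"
      using p unfolding open_ultrafilter_def by (metis equals0I)
    have "x \<in> X closure_of U" if "U \<in> S" for U
      using x that closure_of_subset_Int [of X U] by auto
    then show "\<Inter> ((\<lambda>U. X closure_of U) ` S) \<noteq> {}" by blast
  qed simp
  then obtain x where x: "\<And>U. U \<in> I \<Longrightarrow> x \<in> X closure_of U"
    by auto
  have "topspace X \<in> I"
    using p_top by (simp add: I_def)
  then have "x \<in> topspace X"
    using x closure_of_subset_topspace by (metis subsetD)
  moreover have "open_ultrafilter X (restrict p (Collect (openin X)))"
    using p openin_exterior by (auto simp: open_ultrafilter_def)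
  ultimately have "(x, restrict p (Collect (openin X))) \<in> gleason_set X"
    using x by (auto simp: gleason_set_def I_def)
  then show ?thesis by blast
qed

text \<open>Irreducibility of the projection to \<open>X\<close>. A basic neighbourhood of
  \<open>(x, p)\<close> tests \<open>x\<close> on one open set and \<open>p\<close> on finitely
  many. For each of the latter, \<open>D\<close> lies in the set or in its exterior, as decided by
  \<open>p\<close>, so every ultrafilter over a point of \<open>D\<close> decides alike.\<close>

lemma gleason_open_base:
  assumes \<U>: "openin (gleason_space X) \<U>" "\<U> \<noteq> {}"
  obtains D where "openin X D" "D \<noteq> {}" "\<And>x p. (x, p) \<in> gleason_set X \<Longrightarrow> x \<in> D \<Longrightarrow> (x, p) \<in> \<U>"
proof -
  let ?O = "Collect (openin X)"
  obtain \<V> where \<V>: "openin (gleason_ambient X) \<V>" "\<U> = \<V> \<inter> gleason_set X"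
    using \<U>(1) unfolding gleason_space_def openin_subtopology by blast
  obtain x p where xp: "(x, p) \<in> \<V>" "(x, p) \<in> gleason_set X"
    using \<U>(2) \<V>(2) by auto
  obtain A B where A: "openin X A" "x \<in> A" and AB: "A \<times> B \<subseteq> \<V>" and "p \<in> B"
    and B: "openin (product_topology (\<lambda>_. discrete_topology (UNIV :: bool set)) ?O) B"
    using \<V>(1) xp(1) unfolding gleason_ambient_def openin_prod_topology_alt by meson
  obtain W where W: "finite {U \<in> ?O. W U \<noteq> UNIV}" "p \<in> Pi\<^sub>E ?O W" "Pi\<^sub>E ?O W \<subseteq> B"
    using B \<open>p \<in> B\<close> unfolding openin_product_topology_alt by fastforce
  define I where "I = {U \<in> ?O. W U \<noteq> UNIV}"
  define r where "r U = (if p U then U else exterior X U)" for U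
  have p: "open_ultrafilter X p"
    using xp(2) by (simp add: gleason_set_def)
  have r: "openin X (r U) \<and> p (r U)" if "openin X U" for U
    using that open_ultrafilter_exterior_iff [OF p that] by (auto simp: r_def openin_exterior)
  define D where "D = \<Inter> (insert A (r ` I))"
  have D: "openin X D \<and> p D"
    unfolding D_def
    by (rule open_ultrafilter_Inter [OF p])
      (use W(1) A gleason_mem_open [OF xp(2) A] r in \<open>auto simp: I_def\<close>)
  show thesis
  proof (rule that [of D])
    show "D \<noteq> {}"
      using D p by (auto simp: open_ultrafilter_def)
    fix y q assume yq: "(y, q) \<in> gleason_set X" and y: "y \<in> D"
    have q: "open_ultrafilter X q" and ext: "q \<in> extensional ?O"
      using yq by (simp_all add: gleason_set_def)
    have "q U = p U" if U: "U \<in> I" for U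
    proof -
      have op: "openin X U" using U by (simp add: I_def)
      have "y \<in> r U" using y U by (auto simp: D_def)
      then have "q (r U)"
        using gleason_mem_open [OF yq] r [OF op] by blast
      then show ?thesis
        using open_ultrafilter_exterior_iff [OF q op] by (auto simp: r_def split: if_splits)
    qed
    then have "q \<in> Pi\<^sub>E ?O W"
      using W(2) ext by (force simp: PiE_iff I_def)
    then show "(y, q) \<in> \<U>"
      using W(3) AB y yq \<V>(2) by (auto simp: D_def)
  qed (use D in blast)
qed

section \<open>The action on the Gleason cover\<close>

context homeo_action
begin

definition pull :: "'a \<Rightarrow> 'x set \<Rightarrow> 'x set" where
  "pull g U = {x \<in> topspace X. \<phi> g x \<in> U}"

lemma openin_pull: "g \<in> carrier G \<Longrightarrow> openin X U \<Longrightarrow> openin X (pull g U)"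
  unfolding pull_def by (rule openin_action_preimage)

lemma pull_empty [simp]: "pull g {} = {}"
  by (simp add: pull_def)

lemma pull_Int: "pull g (U \<inter> V) = pull g U \<inter> pull g V"
  by (auto simp: pull_def)

lemma pull_mult:
  "g \<in> carrier G \<Longrightarrow> h \<in> carrier G \<Longrightarrow> pull (g \<otimes> h) U = pull h (pull g U)"
  by (auto simp: pull_def action_mult)

lemma pull_one: "openin X U \<Longrightarrow> pull \<one> U = U"
  using openin_subset by (fastforce simp: pull_def)

lemma pull_eq_image:
  assumes "g \<in> carrier G" "U \<subseteq> topspace X"
  shows "pull g U = \<phi> (inv g) ` U"
proof
  show "pull g U \<subseteq> \<phi> (inv g) ` U"
  proof
    fix x assume "x \<in> pull g U"
    then show "x \<in> \<phi> (inv g) ` U"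
      using assms by (intro image_eqI [of _ _ "\<phi> g x"]) (auto simp: pull_def)
  qed
  show "\<phi> (inv g) ` U \<subseteq> pull g U"
    using assms by (auto simp: pull_def subset_iff)
qed

lemma pull_closure_of:
  assumes "g \<in> carrier G" "U \<subseteq> topspace X"
  shows "pull g (X closure_of U) = X closure_of (pull g U)"
  using assms homeomorphic_map_closure_of [OF action_homeo [of "inv g"], of U]
  by (simp add: pull_eq_image closure_of_subset_topspace)

lemma pull_exterior:
  assumes "g \<in> carrier G" "U \<subseteq> topspace X"
  shows "pull g (exterior X U) = exterior X (pull g U)"
proof -
  have "pull g (exterior X U) = topspace X - pull g (X closure_of U)"
    using assms(1) by (auto simp: pull_def exterior_def)
  then show ?thesis
    using assms by (simp add: pull_closure_of exterior_def)
qed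

text \<open>On ultrafilters this is the push-forward; preimages reverse products, so it is a left
  action again.\<close>

definition gleason_act :: "'a \<Rightarrow> 'x \<times> ('x set \<Rightarrow> bool) \<Rightarrow> 'x \<times> ('x set \<Rightarrow> bool)" where
  "gleason_act g = (\<lambda>q\<in>gleason_set X. (\<phi> g (fst q), \<lambda>U\<in>Collect (openin X). snd q (pull g U)))"

lemma gleason_act_closed:
  assumes g: "g \<in> carrier G" and q: "q \<in> gleason_set X"
  shows "gleason_act g q \<in> gleason_set X"
proof -
  obtain x p where xp: "q = (x, p)" by (cases q)
  have x: "x \<in> topspace X" and p: "open_ultrafilter X p"
    and cl: "\<And>U. openin X U \<Longrightarrow> p U \<Longrightarrow> x \<in> X closure_of U"
    using q xp by (auto simp: gleason_set_def)
  have "open_ultrafilter X (\<lambda>U\<in>Collect (openin X). p (pull g U))"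
    unfolding open_ultrafilter_def
  proof (intro conjI allI impI)
    fix U assume U: "openin X U"
    have "p (pull g U) \<or> p (exterior X (pull g U))"
      using p openin_pull [OF g U] by (auto simp: open_ultrafilter_def)
    then show "(\<lambda>U\<in>Collect (openin X). p (pull g U)) U \<or>
        (\<lambda>U\<in>Collect (openin X). p (pull g U)) (exterior X U)"
      using U openin_exterior pull_exterior [OF g openin_subset [OF U]] by auto
  qed (use p openin_pull [OF g] in \<open>auto simp: open_ultrafilter_def pull_Int\<close>)
  moreover have "\<phi> g x \<in> X closure_of U" if U: "openin X U" "p (pull g U)" for U
  proof -
    have "x \<in> pull g (X closure_of U)"
      using cl [OF openin_pull [OF g U(1)] U(2)] pull_closure_of [OF g openin_subset [OF U(1)]] by simp
    then show ?thesis by (simp add: pull_def)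
  qed
  ultimately show ?thesis
    using q xp x g by (auto simp: gleason_act_def gleason_set_def)
qed

lemma gleason_action: "action_by_homeos G (gleason_space X) gleason_act"
proof (rule action_by_homeosI [OF is_group])
  let ?O = "Collect (openin X)"
  show "gleason_act g \<in> extensional (topspace (gleason_space X))" for g
    by (simp add: gleason_act_def)
  show "continuous_map (gleason_space X) (gleason_space X) (gleason_act g)" if g: "g \<in> carrier G" for g
  proof -
    have "continuous_map (gleason_ambient X) X (\<lambda>q. \<phi> g (fst q))"
      using continuous_map_compose [OF gleason_ambient_fst action_continuous [OF g]] by (simp add: o_def)
    moreover have "continuous_map (gleason_ambient X)
        (product_topology (\<lambda>_. discrete_topology UNIV) ?O) (\<lambda>q. \<lambda>U\<in>?O. snd q (pull g U))"
      using gleason_ambient_eval openin_pull [OF g] by (auto simp: continuous_map_componentwise)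
    ultimately have "continuous_map (gleason_ambient X) (gleason_ambient X)
        (\<lambda>q. (\<phi> g (fst q), \<lambda>U\<in>?O. snd q (pull g U)))"
      by (subst (2) gleason_ambient_def) (rule continuous_map_pairedI)
    then have "continuous_map (gleason_space X) (gleason_ambient X)
        (\<lambda>q. (\<phi> g (fst q), \<lambda>U\<in>?O. snd q (pull g U)))"
      unfolding gleason_space_def by (rule continuous_map_from_subtopology)
    then have "continuous_map (gleason_space X) (gleason_ambient X) (gleason_act g)"
      by (rule continuous_map_eq) (auto simp: gleason_act_def)
    then have "continuous_map (gleason_space X) (subtopology (gleason_ambient X) (gleason_set X))
        (gleason_act g)"
      using gleason_act_closed [OF g] by (intro continuous_map_into_subtopology) auto
    then show ?thesis
      by (simp only: gleason_space_def [symmetric])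
  qed
  show "gleason_act (g \<otimes> h) q = gleason_act g (gleason_act h q)"
    if "g \<in> carrier G" "h \<in> carrier G" "q \<in> topspace (gleason_space X)" for g h q
  proof -
    have q: "q \<in> gleason_set X" "fst q \<in> topspace X"
      using that by (auto simp: gleason_set_def)
    have "(\<lambda>U\<in>?O. snd q (pull (g \<otimes> h) U)) = (\<lambda>U\<in>?O. (\<lambda>U\<in>?O. snd q (pull h U)) (pull g U))"
      using that by (intro restrict_ext) (simp add: pull_mult openin_pull)
    moreover have "gleason_act h q \<in> gleason_set X"
      using that(2) q(1) by (rule gleason_act_closed)
    ultimately show ?thesis
      using q that by (simp add: gleason_act_def action_mult)
  qed
  show "gleason_act \<one> q = q" if "q \<in> topspace (gleason_space X)" for q
  proof -
    have q: "q \<in> gleason_set X" "fst q \<in> topspace X" "snd q \<in> extensional ?O"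
      using that by (auto simp: gleason_set_def)
    have "(\<lambda>U\<in>?O. snd q (pull \<one> U)) = snd q"
      by (rule extensionalityI [of _ ?O]) (use q in \<open>auto simp: pull_one\<close>)
    then show ?thesis
      using q by (simp add: gleason_act_def)
  qed
qed

end

text \<open>Contraction lifts from \<open>X\<close>: a non-empty open set of the cover contains the
  full preimage of a non-empty open set of \<open>X\<close>, so it suffices to move the first
  components.\<close>

lemma gleason_minimal_proximal:
  fixes G (structure)
  assumes mp: "minimal_proximal_space G X \<phi>"
  shows "minimal_proximal_space G (gleason_space X) (homeo_action.gleason_act X \<phi>)"
proof -
  interpret homeo_action G X \<phi>
    using mp by (simp add: homeo_action_def minimal_proximal_space_def)
  interpret gl: homeo_action G "gleason_space X" gleason_act
    by (simp add: homeo_action_def gleason_action)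
  have X: "topspace X \<noteq> {}" "compact_space X" "Hausdorff_space X"
    using mp by (auto simp: minimal_proximal_space_def)
  have "contracting (carrier G) (gleason_space X) gleason_act"
    unfolding contracting_def
  proof (intro allI impI, elim conjE)
    fix S \<U> assume S: "finite S" "S \<subseteq> topspace (gleason_space X)"
      and \<U>: "openin (gleason_space X) \<U>" "\<U> \<noteq> {}"
    obtain D where D: "openin X D" "D \<noteq> {}"
      and DU: "\<And>x p. (x, p) \<in> gleason_set X \<Longrightarrow> x \<in> D \<Longrightarrow> (x, p) \<in> \<U>"
      using gleason_open_base [OF \<U>] by metis
    have S': "S \<subseteq> gleason_set X"
      using S by simp
    have "finite (fst ` S)" "fst ` S \<subseteq> topspace X"
      using S(1) S' by (auto simp: gleason_set_def)
    from contractingD [OF minimal_proximal_space_contracting [OF mp] this D]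
    obtain g where g: "g \<in> carrier G" "\<forall>x\<in>fst ` S. \<phi> g x \<in> D"
      by blast
    have "gleason_act g q \<in> \<U>" if q: "q \<in> S" for q
    proof -
      have "gleason_act g q \<in> gleason_set X"
        using g(1) q S' by (intro gleason_act_closed) auto
      moreover have "fst (gleason_act g q) \<in> D"
        using g(2) q S' by (auto simp: gleason_act_def)
      ultimately show ?thesis
        using DU [of "fst (gleason_act g q)" "snd (gleason_act g q)"] by simp
    qed
    then show "\<exists>g\<in>carrier G. \<forall>q\<in>S. gleason_act g q \<in> \<U>"
      using g(1) by blast
  qed
  then show ?thesis
    using X by (intro gl.minimal_proximal_spaceI)
      (auto simp: gleason_nonempty gleason_compact gleason_Hausdorff)
qed

text \<open>Universality gives a map \<open>\<sigma>\<close> to the Gleason cover, a section of the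
  projection by uniqueness of equivariant maps. Then the closure of \<open>U\<close> is the preimage
  under \<open>\<sigma>\<close> of the clopen set of ultrafilters containing
  \<open>U\<close>.\<close>

lemma universal_minimal_proximal_extremally_disconnected:
  fixes G (structure)
  assumes univ: "universal_minimal_proximal_space G X \<phi>" and U: "openin X U"
  shows "openin X (X closure_of U)"
proof -
  have mp: "minimal_proximal_space G X \<phi>"
    using univ by (simp add: universal_minimal_proximal_space_def)
  interpret homeo_action G X \<phi>
    using mp by (simp add: homeo_action_def minimal_proximal_space_def)
  obtain \<sigma> where \<sigma>: "continuous_map X (gleason_space X) \<sigma>"
      "\<And>g x. g \<in> carrier G \<Longrightarrow> x \<in> topspace X \<Longrightarrow> \<sigma> (\<phi> g x) = gleason_act g (\<sigma> x)"
    using universal_minimal_proximal_space_image [OF univ gleason_minimal_proximal [OF mp]]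
    unfolding equivariant_image_def by blast
  have \<sigma>_set: "\<sigma> x \<in> gleason_set X" if "x \<in> topspace X" for x
    using continuous_map_image_subset_topspace [OF \<sigma>(1)] that by auto
  have \<sigma>_ambient: "continuous_map X (gleason_ambient X) \<sigma>"
    using \<sigma>(1) by (simp add: gleason_space_def continuous_map_in_subtopology)
  have con: "contracting (carrier G) X \<phi>"
    using mp by (rule minimal_proximal_space_contracting)
  have X: "compact_space X" "Hausdorff_space X"
    using mp by (auto simp: minimal_proximal_space_def)
  have fst_\<sigma>: "fst (\<sigma> x) = x" if x: "x \<in> topspace X" for x
  proof -
    have "continuous_map X X (\<lambda>x. fst (\<sigma> x))"
      using continuous_map_compose [OF \<sigma>_ambient gleason_ambient_fst] by (simp add: o_def)
    then show ?thesis
      using x \<sigma>(2) \<sigma>_set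
      by (intro contracting_equivariant_unique [where f = "\<lambda>x. fst (\<sigma> x)" and g = "\<lambda>x. x",
            OF X con con]) (auto simp: gleason_act_def)
  qed
  have "X closure_of U = {x \<in> topspace X. snd (\<sigma> x) U \<in> {True}}"
  proof (rule closure_of_unique)
    have mem: "(x, snd (\<sigma> x)) \<in> gleason_set X" if "x \<in> topspace X" for x
      using \<sigma>_set [OF that] fst_\<sigma> [OF that] by (metis prod.collapse)
    show "U \<subseteq> {x \<in> topspace X. snd (\<sigma> x) U \<in> {True}}"
      using gleason_mem_open [OF mem U] openin_subset [OF U] by auto
    have "continuous_map X (discrete_topology UNIV) (\<lambda>x. snd (\<sigma> x) U)"
      using continuous_map_compose [OF \<sigma>_ambient gleason_ambient_eval [OF U]] by (simp add: o_def)
    then show "closedin X {x \<in> topspace X. snd (\<sigma> x) U \<in> {True}}"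
      by (rule closedin_continuous_map_preimage) simp
    fix T assume T: "U \<subseteq> T" "closedin X T"
    have "x \<in> X closure_of U" if "x \<in> topspace X" "snd (\<sigma> x) U" for x
      using mem [OF that(1)] U that(2) by (auto simp: gleason_set_def)
    moreover have "X closure_of U \<subseteq> T"
      using T by (rule closure_of_minimal)
    ultimately show "{x \<in> topspace X. snd (\<sigma> x) U \<in> {True}} \<subseteq> T"
      by auto
  qed
  moreover have "openin X {x \<in> topspace X. snd (\<sigma> x) U \<in> {True}}"
  proof (rule openin_continuous_map_preimage)
    show "continuous_map X (discrete_topology UNIV) (\<lambda>x. snd (\<sigma> x) U)"
      using continuous_map_compose [OF \<sigma>_ambient gleason_ambient_eval [OF U]] by (simp add: o_def)
  qed simp
  ultimately show ?thesis by simp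
qed

section \<open>Fixed points in extremally disconnected spaces\<close>

text \<open>Frolik's argument: a maximal open \<open>U\<close> disjoint from its image is clopen,
  and \<open>U\<close>, its image and its preimage together are exactly the points that
  move.\<close>

lemma extremally_disconnected_fixed_points_open:
  assumes X: "Hausdorff_space X" and ed: "\<And>U. openin X U \<Longrightarrow> openin X (X closure_of U)"
    and f: "homeomorphic_map X X f"
  shows "openin X {x \<in> topspace X. f x = x}"
proof -
  have cont: "continuous_map X X f" and inj: "inj_on f (topspace X)"
    using f by (auto simp: homeomorphic_eq_everything_map)
  have fX: "f x \<in> topspace X" if "x \<in> topspace X" for x
    using continuous_map_image_subset_topspace [OF cont] that by blast
  define \<W> where "\<W> = {U. openin X U \<and> f ` U \<inter> U = {}}"
  have "\<exists>U\<in>\<W>. \<forall>V\<in>\<W>. U \<subseteq> V \<longrightarrow> V = U"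
  proof (rule subset_Zorn_nonempty)
    show "\<W> \<noteq> {}" by (auto simp: \<W>_def intro!: exI [of _ "{}"])
    fix \<C> assume "\<C> \<noteq> {}" "subset.chain \<W> \<C>"
    then have sub: "\<C> \<subseteq> \<W>" and total: "\<And>U V. U \<in> \<C> \<Longrightarrow> V \<in> \<C> \<Longrightarrow> U \<subseteq> V \<or> V \<subseteq> U"
      by (auto simp: subset_chain_def)
    have "f x \<notin> \<Union> \<C>" if x: "x \<in> \<Union> \<C>" for x
    proof
      assume "f x \<in> \<Union> \<C>"
      then obtain U V where UV: "U \<in> \<C>" "V \<in> \<C>" "x \<in> U" "f x \<in> V"
        using x by blast
      then obtain W where "W \<in> \<C>" "x \<in> W" "f x \<in> W"
        using total [OF UV(1,2)] by blast
      then show False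
        using sub by (auto simp: \<W>_def)
    qed
    then have "f ` \<Union> \<C> \<inter> \<Union> \<C> = {}" by blast
    moreover have "openin X (\<Union> \<C>)"
      using sub by (auto simp: \<W>_def)
    ultimately show "\<Union> \<C> \<in> \<W>" by (simp add: \<W>_def)
  qed
  then obtain U where U_mem: "U \<in> \<W>" and U_max: "\<forall>V\<in>\<W>. U \<subseteq> V \<longrightarrow> V = U"
    by blast
  have U: "openin X U" "f ` U \<inter> U = {}"
    using U_mem by (simp_all add: \<W>_def)
  have max: "V = U" if "openin X V" "f ` V \<inter> V = {}" "U \<subseteq> V" for V
    using U_max that by (simp add: \<W>_def)
  have UX: "U \<subseteq> topspace X" using U(1) by (rule openin_subset)
  \<comment> \<open>Disjoint open sets have disjoint closures here, so the closure of
    \<open>U\<close> is again disjoint from its image, and maximality makes \<open>U\<close>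
    closed.\<close>
  have fU_open: "openin X (f ` U)"
    using homeomorphic_map_openness [OF f UX] U(1) by blast
  have "f ` U \<inter> X closure_of U = {}"
    using openin_Int_closure_of_eq_empty [OF fU_open] U(2) by blast
  then have "X closure_of U \<inter> X closure_of (f ` U) = {}"
    using openin_Int_closure_of_eq_empty [OF ed [OF U(1)], of "f ` U"] by blast
  moreover have "f ` (X closure_of U) = X closure_of (f ` U)"
    using homeomorphic_map_closure_of [OF f UX] by simp
  ultimately have "f ` (X closure_of U) \<inter> X closure_of U = {}" by blast
  then have "X closure_of U = U"
    using max [OF ed [OF U(1)]] closure_of_subset [OF UX] by blast
  then have U_closed: "closedin X U"
    by (metis closedin_closure_of)
  have fU_closed: "closedin X (f ` U)"
    using homeomorphic_map_closedness [OF f UX] U_closed by blast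
  define A where "A = U \<union> f ` U \<union> {x \<in> topspace X. f x \<in> U}"
  have A: "closedin X A"
    unfolding A_def using U_closed fU_closed closedin_continuous_map_preimage [OF cont U_closed]
    by (intro closedin_Un)
  have "f x = x" if x: "x \<in> topspace X" "x \<notin> A" for x
  proof (rule ccontr)
    assume "f x \<noteq> x"
    then obtain V W where VW: "openin X V" "openin X W" "x \<in> V" "f x \<in> W" "disjnt V W"
      using X x(1) fX [OF x(1)] unfolding Hausdorff_space_def by metis
    \<comment> \<open>Avoiding the image and the preimage of \<open>U\<close>, and being disjoint
      from its own image, \<open>N\<close> can be added to \<open>U\<close>; by maximality it lies
      in \<open>U\<close> already.\<close>
    define N where "N = V \<inter> {u \<in> topspace X. f u \<in> W} \<inter> (topspace X - A)"
    have "openin X N"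
      unfolding N_def using VW openin_continuous_map_preimage [OF cont VW(2)] A by auto
    have "f ` N \<inter> N = {}" "f ` N \<inter> U = {}" "f ` U \<inter> N = {}"
      using VW(5) by (auto simp: N_def A_def disjnt_iff)
    then have "f ` (U \<union> N) \<inter> (U \<union> N) = {}"
      using U(2) by blast
    then have "U \<union> N = U"
      using max [of "U \<union> N"] U(1) \<open>openin X N\<close> by auto
    moreover have "x \<in> N"
      using VW x by (auto simp: N_def)
    ultimately show False
      using x(2) by (auto simp: A_def)
  qed
  \<comment> \<open>A fixed point in any of the three pieces would lie in \<open>U\<close>, which is
    disjoint from its image.\<close>
  moreover have "f x \<noteq> x" if x: "x \<in> A" for x
  proof
    assume fx: "f x = x"
    consider "x \<in> U" | u where "u \<in> U" "x = f u" | "f x \<in> U"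
      using x by (auto simp: A_def)
    then have "x \<in> U"
    proof cases
      case (2 u)
      then have "u = f u"
        using fx inj UX fX by (metis inj_onD subsetD)
      then show ?thesis using 2 by simp
    qed (use fx in auto)
    then show False using fx U(2) by force
  qed
  ultimately have "{x \<in> topspace X. f x = x} = topspace X - A"
    by auto
  then show ?thesis using A by auto
qed

section \<open>The extended action\<close>

context commensurated_boundary
begin

text \<open>Both sides are the action of \<open>s \<otimes> h = conjugate s h \<otimes> s\<close>,
  so every extension satisfies the law to which rigidity applies.\<close>

lemma extending_conjugate:
  assumes ext: "extending_action G L X \<phi> \<Psi>"
    and s: "s \<in> carrier G" and h: "h \<in> L" "conjugate s h \<in> L" and x: "x \<in> topspace X"
  shows "\<Psi> s (\<phi> h x) = \<phi> (conjugate s h) (\<Psi> s x)"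
proof -
  interpret ext: homeo_action G X \<Psi>
    using ext by (simp add: extending_action_def homeo_action_def)
  have agree: "\<Psi> k y = \<phi> k y" if "k \<in> L" "y \<in> topspace X" for k y
    using ext that by (simp add: extending_action_def)
  have "\<Psi> s (\<phi> h x) = \<Psi> (s \<otimes> h) x"
    using s h x by (simp add: ext.action_mult flip: agree)
  also have "\<dots> = \<Psi> (conjugate s h \<otimes> s) x"
    using s h by (simp add: conjugate_mult_right)
  also have "\<dots> = \<phi> (conjugate s h) (\<Psi> s x)"
    using s h x by (simp add: ext.action_mult agree)
  finally show ?thesis .
qed

lemma extending_continuous:
  "extending_action G L X \<phi> \<Psi> \<Longrightarrow> s \<in> carrier G \<Longrightarrow> continuous_map X X (\<Psi> s)"
  by (simp add: extending_action_def action_by_homeos_def homeomorphic_imp_continuous_map)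

lemma extending_unique:
  assumes ext: "extending_action G L X \<phi> \<Psi>" "extending_action G L X \<phi> \<Psi>'"
    and s: "s \<in> carrier G" and x: "x \<in> topspace X"
  shows "\<Psi> s x = \<Psi>' s x"
  by (rule conjugate_equivariant_unique [of "{s}" s])
    (use ext s x in \<open>auto simp: extending_continuous conj_into_def intro!: extending_conjugate\<close>)

text \<open>The action laws follow from rigidity, as the two sides of each law are continuous and
  intertwine the same elements.\<close>

lemma extending_action_exists:
  assumes univ: "universal_minimal_proximal_space (G\<lparr>carrier := L\<rparr>) X \<phi>"
  obtains \<Psi> where "\<Psi> \<in> extensional (carrier G)" "extending_action G L X \<phi> \<Psi>"
proof -
  obtain \<Phi> where cont: "\<And>s. s \<in> carrier G \<Longrightarrow> continuous_map X X (\<Phi> s)"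
    and equiv: "\<And>s h x. s \<in> carrier G \<Longrightarrow> h \<in> L \<Longrightarrow> conjugate s h \<in> L \<Longrightarrow> x \<in> topspace X \<Longrightarrow>
      \<Phi> s (\<phi> h x) = \<phi> (conjugate s h) (\<Phi> s x)"
    using conjugation_equivariant_maps [OF univ] by metis
  have closed: "\<Phi> s x \<in> topspace X" if "s \<in> carrier G" "x \<in> topspace X" for s x
    using continuous_map_image_subset_topspace [OF cont [OF that(1)]] that(2) by blast
  have mult: "\<Phi> (s \<otimes> t) x = \<Phi> s (\<Phi> t x)"
    if s: "s \<in> carrier G" and t: "t \<in> carrier G" and x: "x \<in> topspace X" for s t x
  \<comment> \<open>Here \<open>t\<close> in \<open>F\<close> lets \<open>h\<close> pass through
    \<open>\<Phi> t\<close>, and \<open>s \<otimes> t\<close> then lets \<open>conjugate t h\<close>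
    pass through \<open>\<Phi> s\<close>.\<close>
  proof (rule conjugate_equivariant_unique [where F = "{t, s \<otimes> t}" and s = "s \<otimes> t"
        and f = "\<Phi> (s \<otimes> t)" and g = "\<lambda>x. \<Phi> s (\<Phi> t x)"])
    show "continuous_map X X (\<lambda>x. \<Phi> s (\<Phi> t x))"
      using continuous_map_compose [OF cont [OF t] cont [OF s]] by (simp add: o_def)
    show "\<Phi> s (\<Phi> t (\<phi> h y)) = \<phi> (conjugate (s \<otimes> t) h) (\<Phi> s (\<Phi> t y))"
      if "h \<in> conj_into {t, s \<otimes> t}" "y \<in> topspace X" for h y
      using that s t closed by (simp add: conj_into_def equiv conjugate_conjugate)
  qed (use s t x cont equiv in \<open>auto simp: conj_into_def\<close>)
  have agree: "\<Phi> k x = \<phi> k x" if k: "k \<in> L" and x: "x \<in> topspace X" for k x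
  proof (rule conjugate_equivariant_unique [where F = "{k}" and s = k and f = "\<Phi> k" and g = "\<phi> k"])
    show "\<phi> k (\<phi> h y) = \<phi> (conjugate k h) (\<phi> k y)"
      if "h \<in> conj_into {k}" "y \<in> topspace X" for h y
      using that k conjugate_mult_right [of k h] by (simp add: conj_into_def flip: act_mult)
  qed (use k x cont equiv in \<open>auto simp: conj_into_def act_continuous\<close>)
  define \<Psi> where "\<Psi> = (\<lambda>s\<in>carrier G. \<lambda>x\<in>topspace X. \<Phi> s x)"
  have "action_by_homeos G X \<Psi>"
  proof (rule action_by_homeosI [OF is_group])
    show "continuous_map X X (\<Psi> s)" if "s \<in> carrier G" for s
      using cont [OF that] by (rule continuous_map_eq) (use that in \<open>simp add: \<Psi>_def\<close>)
  qed (auto simp: \<Psi>_def mult closed agree)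
  then have "extending_action G L X \<phi> \<Psi>"
    by (auto simp: extending_action_def \<Psi>_def agree)
  then show thesis
    by (rule that [rotated]) (simp add: \<Psi>_def)
qed

text \<open>Extensionality fixes the values at indices outside the group, on which an action puts no
  constraint.\<close>

lemma ex1_extending_action:
  assumes univ: "universal_minimal_proximal_space (G\<lparr>carrier := L\<rparr>) X \<phi>"
  shows "\<exists>!\<Psi>. \<Psi> \<in> extensional (carrier G) \<and> extending_action G L X \<phi> \<Psi>"
proof -
  obtain \<Psi> where \<Psi>: "\<Psi> \<in> extensional (carrier G)" "extending_action G L X \<phi> \<Psi>"
    using extending_action_exists [OF univ] .
  have "\<Psi>' = \<Psi>" if \<Psi>': "\<Psi>' \<in> extensional (carrier G)" "extending_action G L X \<phi> \<Psi>'" for \<Psi>'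
  proof (rule extensionalityI [OF \<Psi>'(1) \<Psi>(1)])
    fix s assume s: "s \<in> carrier G"
    show "\<Psi>' s = \<Psi> s"
    proof (rule extensionalityI [of _ "topspace X"])
      show "\<Psi>' s \<in> extensional (topspace X)" "\<Psi> s \<in> extensional (topspace X)"
        using \<Psi>(2) \<Psi>'(2) s homeo_action.action_extensional [of G X]
        by (auto simp: extending_action_def homeo_action_def)
      show "\<Psi>' s x = \<Psi> s x" if "x \<in> topspace X" for x
        using extending_unique [OF \<Psi>'(2) \<Psi>(2) s that] .
    qed
  qed
  with \<Psi> show ?thesis by blast
qed

text \<open>If \<open>conjugate s h = h\<close> for these \<open>h\<close>, the identity satisfies
  the same law as \<open>\<Psi> s\<close>, and rigidity identifies the two.\<close>

lemma centralizing_acts_trivially: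
  assumes ext: "extending_action G L X \<phi> \<Psi>" and s: "s \<in> carrier G"
    and central: "s \<in> centralizer G (conj_into {s})" and x: "x \<in> topspace X"
  shows "\<Psi> s x = x"
proof (rule conjugate_equivariant_unique [where F = "{s}" and s = s and f = "\<Psi> s" and g = "\<lambda>x. x"])
  show "\<phi> h y = \<phi> (conjugate s h) y" if "h \<in> conj_into {s}" for h y
    using that central s conjugate_eq_iff [of s h] conj_into_L
    by (simp add: centralizer_def)
  show "\<Psi> s (\<phi> h y) = \<phi> (conjugate s h) (\<Psi> s y)"
    if "h \<in> conj_into {s}" "y \<in> topspace X" for h y
    using that s by (intro extending_conjugate [OF ext]) (auto simp: conj_into_def)
qed (use s x extending_continuous [OF ext] in auto)

lemma fixed_point_centralizes:
  assumes univ: "universal_minimal_proximal_space (G\<lparr>carrier := L\<rparr>) X \<phi>"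
    and free: "free_action (G\<lparr>carrier := L\<rparr>) X \<phi>"
    and ext: "extending_action G L X \<phi> \<Psi>" and s: "s \<in> carrier G"
    and y: "y \<in> topspace X" "\<Psi> s y = y"
  shows "s \<in> centralizer G (conj_into {s})"
proof -
  interpret ext: homeo_action G X \<Psi>
    using ext by (simp add: extending_action_def homeo_action_def)
  have equiv: "\<Psi> s (\<phi> h x) = \<phi> (conjugate s h) (\<Psi> s x)"
    if "h \<in> conj_into {s}" "x \<in> topspace X" for h x
    using that s by (intro extending_conjugate [OF ext]) (auto simp: conj_into_def)
  \<comment> \<open>Freeness makes each orbit map of \<open>L\<close> injective, so agreement at a
    single point identifies group elements.\<close>
  have inj: "h = k" if hk: "h \<in> L" "k \<in> L" and x: "x \<in> topspace X" and eq: "\<phi> h x = \<phi> k x" for h k x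
  proof -
    have "\<phi> (inv k \<otimes> h) x = \<phi> (inv k \<otimes> k) x"
      using hk x eq by (simp only: act_mult L_inv)
    then have "x \<in> invariants (topspace X) \<phi> (inv k \<otimes> h)"
      using hk x by (simp add: invariants_def)
    then have "inv k \<otimes> h = \<one>"
      using free hk unfolding free_action_def by fastforce
    then show ?thesis
      using hk by (metis L_carrier inv_closed inv_equality inv_inv)
  qed
  define U where "U = {x \<in> topspace X. \<Psi> s x = x}"
  have U: "openin X U" "U \<noteq> {}"
    using extremally_disconnected_fixed_points_open [OF X_Hausdorff
        universal_minimal_proximal_extremally_disconnected [OF univ] ext.action_homeo [OF s]] y
    by (auto simp: U_def)
  have fixed: "\<Psi> s x = x" if x: "x \<in> topspace X" for x
  proof -
    have "contracting (conj_into {s}) X \<phi>"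
      using s by (intro contracting_conj_into) auto
    \<comment> \<open>A single \<open>h\<close> handles both points: \<open>y\<close> serves to show
      that \<open>h\<close> commutes with \<open>s\<close>, and \<open>x\<close> then inherits being
      fixed from \<open>\<phi> h x\<close>.\<close>
    then obtain h where h: "h \<in> conj_into {s}" "\<phi> h x \<in> U" "\<phi> h y \<in> U"
      using contractingD [of _ X \<phi> "{x, y}" U] x y U by auto
    then have hL: "h \<in> L" "conjugate s h \<in> L"
      by (auto simp: conj_into_def)
    have "\<phi> (conjugate s h) y = \<phi> h y"
      using equiv [OF h(1) y(1)] y(2) h(3) by (simp add: U_def)
    then have "conjugate s h = h"
      using inj hL y(1) by blast
    then have "\<phi> h (\<Psi> s x) = \<phi> h x"
      using equiv [OF h(1) x] h(2) by (simp add: U_def)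
    then show ?thesis
      using Lam.inj_prop [of h] hL(1) x s by (auto dest!: inj_onD)
  qed
  \<comment> \<open>Now that \<open>s\<close> acts trivially, \<open>conjugate s h\<close> and
    \<open>h\<close> agree at \<open>y\<close> for every \<open>h\<close> in
    \<open>conj_into {s}\<close>.\<close>
  have "s \<otimes> h = h \<otimes> s" if h: "h \<in> conj_into {s}" for h
  proof -
    have hL: "h \<in> L" "conjugate s h \<in> L"
      using h by (auto simp: conj_into_def)
    have "\<phi> (conjugate s h) y = \<phi> h y"
      using equiv [OF h y(1)] y hL fixed by simp
    then have "conjugate s h = h"
      using inj hL y(1) by blast
    then show ?thesis
      using conjugate_eq_iff s hL by simp
  qed
  then show ?thesis
    using s by (simp add: centralizer_def)
qed

end

theorem theorem5p1:
  fixes \<Gamma> :: "('g, 'b) monoid_scheme" and \<Lambda> :: "'g set"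
    and X :: "'x topology" and \<phi> :: "'g \<Rightarrow> 'x \<Rightarrow> 'x"
  assumes "group \<Gamma>"
    and "commensurated \<Gamma> \<Lambda>"
    and "universal_minimal_proximal_space (\<Gamma>\<lparr>carrier := \<Lambda>\<rparr>) X \<phi>"
  shows "(\<exists>!\<Phi>. \<Phi> \<in> extensional (carrier \<Gamma>) \<and> extending_action \<Gamma> \<Lambda> X \<phi> \<Phi>) \<and>
    (\<forall>\<Phi>. extending_action \<Gamma> \<Lambda> X \<phi> \<Phi> \<longrightarrow>
      (\<forall>s\<in>carrier \<Gamma>.
        (s \<in> centralizer \<Gamma> (\<Lambda> \<inter> (inv\<^bsub>\<Gamma>\<^esub> s <#\<^bsub>\<Gamma>\<^esub> \<Lambda> #>\<^bsub>\<Gamma>\<^esub> s)) \<longrightarrow>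
           invariants (topspace X) \<Phi> s = topspace X) \<and>
        (free_action (\<Gamma>\<lparr>carrier := \<Lambda>\<rparr>) X \<phi> \<and> invariants (topspace X) \<Phi> s \<noteq> {} \<longrightarrow>
           s \<in> centralizer \<Gamma> (\<Lambda> \<inter> (inv\<^bsub>\<Gamma>\<^esub> s <#\<^bsub>\<Gamma>\<^esub> \<Lambda> #>\<^bsub>\<Gamma>\<^esub> s)))))"
proof -
  interpret group \<Gamma> by fact
  interpret commensurated_boundary \<Gamma> \<Lambda> X \<phi>
    by unfold_locales
      (use assms in \<open>auto simp: universal_minimal_proximal_space_def\<close>)
  show ?thesis
  proof (intro conjI allI impI ballI ex1_extending_action assms(3); (elim conjE)?)
    fix \<Phi> s assume ext: "extending_action \<Gamma> \<Lambda> X \<phi> \<Phi>" and s: "s \<in> carrier \<Gamma>"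
    note [simp] = Int_conjugate_eq [OF s]
    show "invariants (topspace X) \<Phi> s = topspace X"
      if "s \<in> centralizer \<Gamma> (\<Lambda> \<inter> (inv\<^bsub>\<Gamma>\<^esub> s <#\<^bsub>\<Gamma>\<^esub> \<Lambda> #>\<^bsub>\<Gamma>\<^esub> s))"
      using that centralizing_acts_trivially [OF ext s] by (auto simp: invariants_def)
    show "s \<in> centralizer \<Gamma> (\<Lambda> \<inter> (inv\<^bsub>\<Gamma>\<^esub> s <#\<^bsub>\<Gamma>\<^esub> \<Lambda> #>\<^bsub>\<Gamma>\<^esub> s))"
      if "free_action (\<Gamma>\<lparr>carrier := \<Lambda>\<rparr>) X \<phi>" "invariants (topspace X) \<Phi> s \<noteq> {}"
      using that fixed_point_centralizes [OF assms(3) that(1) ext s] by (auto simp: invariants_def)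
  qed
qed

end
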